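(* Consider the lattice $x(s)=\mathfrak{c}_4s^2+\mathfrak{c}_5s+\mathfrak{c}_6$ with $\mathfrak{c}_4,\mathfrak{c}_5,\mathfrak{c}_6\in\mathbb{C}$, $(\mathfrak{c}_4,\mathfrak{c}_5,\mathfrak{c}_6)\neq(0,0,0)$, and put $\beta:=\mathfrak{c}_4/4$. Let ${\bf u}\in\mathcal{P}^*\setminus\{{\bf 0}\}$ and suppose that there exists $(\phi,\psi)\in\mathcal{P}_2\times\mathcal{P}_1\setminus\{(0,0)\}$ such that $$\mathbf{D}_x(\phi{\bf u})=\mathbf{S}_x(\psi{\bf u}).$$ Write $\phi(z)=az^2+bz+c$ and $\psi(z)=dz+e$ with $a,b,c,d,e\in\mathbb{C}$. Then ${\bf u}$ is regular if and only if $$d_n\neq0\quad\text{and}\quad\phi^{[n]}\left(-\beta n^2-\frac{e_n}{d_{2n}}\right)\neq0\qquad\text{for all }n=0,1,\ldots,$$ where $d_n:=an+d$, $e_n:=bn+e+2\beta dn^2$, and $$\phi^{[n]}(z)=az^2+(b+6\beta nd_n)z+\phi(\beta n^2)+2\beta n\,\psi(\beta n^2)-\frac n4\big(16\beta\mathfrak{c}_6-\mathfrak{c}_5^2\big)d_n.$$ Under these conditions, the monic OPS $(P_n)_{n\ge0}$ with respect to ${\bf u}$ satisfies $$P_{n+1}(z)=(z-B_n)P_n(z)-C_nP_{n-1}(z)\quad(n=0,1,\ldots),\qquad P_{-1}(z)=0,$$ where, for $n=0,1,\ldots$, $$B_n=\frac{ne_{n-1}}{d_{2n-2}}-\frac{(n+1)e_n}{d_{2n}}-2\beta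 n(n-1),\qquad C_{n+1}=-\frac{(n+1)d_{n-1}}{d_{2n-1}d_{2n+1}}\,\phi^{[n]}\left(-\beta n^2-\frac{e_n}{d_{2n}}\right).$$ (For $n=0$, the term $ne_{n-1}/d_{2n-2}$ is read as $0$, and the quotient $d_{n-1}/d_{2n-1}$ is read as $1$.) Moreover, the following functional Rodrigues formula holds: $$P_n{\bf u}=k_n\,\mathbf{D}_x^n{\bf u}^{[n]},\qquad k_n:=(-1)^n\prod_{j=1}^nd_{n+j-2}^{-1}\qquad(n=0,1,\ldots).$$
   Context: $\mathcal{P}$ is the vector space of complex polynomials in $z$, $\mathcal{P}_n$ the subspace of polynomials of degree at most $n$, $\mathcal{P}^*$ the algebraic dual of $\mathcal{P}$, and $\langle{\bf u},f\rangle$ the action of ${\bf u}\in\mathcal{P}^*$ on $f\in\mathcal{P}$. For $g\in\mathcal{P}$, $g{\bf u}\in\mathcal{P}^*$ is defined by $\langle g{\bf u},f\rangle:=\langle{\bf u},fg\rangle$. An orthogonal polynomial sequence (OPS) with respect to ${\bf u}$ is a sequence $(P_n)_{n\ge0}$ with $\deg P_n=n$ and $\langle{\bf u},P_nP_k\rangle=h_n\delta_{n,k}$, $h_n\in\mathbb{C}\setminus\{0\}$, for all $n,k\ge0$; it is monic if every $P_n$ is monic. ${\bf u}$ is called regular if there exists an OPS with respect to it. The operators $\mathrm{D}_x,\mathrm{S}_x:\mathcal{P}\to\mathcal{P}$ are defined, for $f\in\mathcal{P}$, as the polynomials satisfying (identically in $s$) $$\mathrm{D}_xf(x(s))=\frac{f(x(s+\frac12))-f(x(s-\frac12))}{x(s+\frac12)-x(s-\frac12)},\qquad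 \mathrm{S}_xf(x(s))=\frac{f(x(s+\frac12))+f(x(s-\frac12))}{2}.$$ If the lattice is constant ($\mathfrak{c}_4=\mathfrak{c}_5=0$) these are understood in the limiting sense: $\mathrm{D}_xf=f'$ and $\mathrm{S}_xf=f$. They induce operators on $\mathcal{P}^*$: $\langle\mathbf{D}_x{\bf u},f\rangle:=-\langle{\bf u},\mathrm{D}_xf\rangle$ and $\langle\mathbf{S}_x{\bf u},f\rangle:=\langle{\bf u},\mathrm{S}_xf\rangle$ for $f\in\mathcal{P}$. Let $U_1(z):=2\beta=\frac12\mathfrak{c}_4$ and $U_2(z):=\mathfrak{c}_4(z-\mathfrak{c}_6)+\frac14\mathfrak{c}_5^2$. Polynomials $\phi^{[k]}\in\mathcal{P}_2$, $\psi^{[k]}\in\mathcal{P}_1$ and functionals ${\bf u}^{[k]}\in\mathcal{P}^*$ are defined recursively by $\phi^{[0]}:=\phi$, $\psi^{[0]}:=\psi$, ${\bf u}^{[0]}:={\bf u}$ and $$\phi^{[k+1]}:=\mathrm{S}_x\phi^{[k]}+U_1\mathrm{S}_x\psi^{[k]}+U_2\mathrm{D}_x\psi^{[k]},\quad \psi^{[k+1]}:=\mathrm{D}_x\phi^{[k]}+\mathrm{S}_x\psi^{[k]}+U_1\mathrm{D}_x\psi^{[k]},$$ $${\bf u}^{[k+1]}:=\mathbf{D}_x\big(U_2\psi^{[k]}{\bf u}^{[k]}\big)-\mathbf{S}_x\big(\phi^{[k]}{\bf u}^{[k]}\big)\qquad(k=0,1,\ldots);$$ the polynomials $\phi^{[n]}$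 in the claim are the explicit form of these $\phi^{[n]}$. *)

theory Defs
  imports Complex_Main "HOL-Computational_Algebra.Polynomial"
begin

definition quad_lattice :: "complex \<Rightarrow> complex \<Rightarrow> complex \<Rightarrow> complex \<Rightarrow> complex" where
  "quad_lattice c4 c5 c6 s = c4 * s^2 + c5 * s + c6"

text \<open>The quotient is required only where its denominator, which equals \<open>2 * c4 * s + c5\<close>,
  does not vanish (Isabelle's \<open>x / 0 = 0\<close> would otherwise impose a spurious condition).
  For a constant lattice the operators are the limits, i.e. the derivative and the identity.
  In all other cases the descriptions are proper: see \<open>Dx_ex1\<close> and \<open>Sx_ex1\<close> below.\<close>

definition Dx :: "complex \<Rightarrow> complex \<Rightarrow> complex \<Rightarrow> complex poly \<Rightarrow> complex poly" where
  "Dx c4 c5 c6 f =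
     (let x = quad_lattice c4 c5 c6 in
      if c4 = 0 \<and> c5 = 0 then pderiv f
      else THE g. \<forall>s. x (s + 1/2) \<noteq> x (s - 1/2) \<longrightarrow>
             poly g (x s) = (poly f (x (s + 1/2)) - poly f (x (s - 1/2)))
                              / (x (s + 1/2) - x (s - 1/2)))"

definition Sx :: "complex \<Rightarrow> complex \<Rightarrow> complex \<Rightarrow> complex poly \<Rightarrow> complex poly" where
  "Sx c4 c5 c6 f =
     (let x = quad_lattice c4 c5 c6 in
      if c4 = 0 \<and> c5 = 0 then f
      else THE g. \<forall>s. poly g (x s) = (poly f (x (s + 1/2)) + poly f (x (s - 1/2))) / 2)"

text \<open>Elements of the algebraic dual of the space of polynomials are functions \<open>u\<close> satisfying
  \<open>poly_functional u\<close>; they are combined pointwise.\<close>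

definition poly_functional :: "(complex poly \<Rightarrow> complex) \<Rightarrow> bool" where
  "poly_functional u \<longleftrightarrow> Vector_Spaces.linear smult (*) u"

definition fun_mult :: "complex poly \<Rightarrow> (complex poly \<Rightarrow> complex) \<Rightarrow> complex poly \<Rightarrow> complex" where
  "fun_mult g u = (\<lambda>f. u (f * g))"

definition Dx_dual :: "complex \<Rightarrow> complex \<Rightarrow> complex \<Rightarrow> (complex poly \<Rightarrow> complex) \<Rightarrow> complex poly \<Rightarrow> complex"
  where "Dx_dual c4 c5 c6 u = (\<lambda>f. - u (Dx c4 c5 c6 f))"

definition Sx_dual :: "complex \<Rightarrow> complex \<Rightarrow> complex \<Rightarrow> (complex poly \<Rightarrow> complex) \<Rightarrow> complex poly \<Rightarrow> complex"
  where "Sx_dual c4 c5 c6 u = (\<lambda>f. u (Sx c4 c5 c6 f))"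

text \<open>The zero polynomial has \<open>degree\<close> 0 in Isabelle, but \<open>h 0 \<noteq> 0\<close> forces \<open>P 0 \<noteq> 0\<close>.\<close>

definition is_OPS :: "(complex poly \<Rightarrow> complex) \<Rightarrow> (nat \<Rightarrow> complex poly) \<Rightarrow> bool" where
  "is_OPS u P \<longleftrightarrow> (\<forall>n. degree (P n) = n) \<and>
     (\<exists>h. (\<forall>n. h n \<noteq> 0) \<and> (\<forall>n k. u (P n * P k) = (if n = k then h n else 0)))"

definition is_monic_OPS :: "(complex poly \<Rightarrow> complex) \<Rightarrow> (nat \<Rightarrow> complex poly) \<Rightarrow> bool" where
  "is_monic_OPS u P \<longleftrightarrow> is_OPS u P \<and> (\<forall>n. lead_coeff (P n) = 1)"

definition regular :: "(complex poly \<Rightarrow> complex) \<Rightarrow> bool" where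
  "regular u \<longleftrightarrow> (\<exists>P. is_OPS u P)"

definition U1 :: "complex \<Rightarrow> complex poly" where
  "U1 c4 = [:c4 / 2:]"

definition U2 :: "complex \<Rightarrow> complex \<Rightarrow> complex \<Rightarrow> complex poly" where
  "U2 c4 c5 c6 = smult c4 [:- c6, 1:] + [:c5^2 / 4:]"

fun phi_seq psi_seq ::
  "complex \<Rightarrow> complex \<Rightarrow> complex \<Rightarrow> complex poly \<Rightarrow> complex poly \<Rightarrow> nat \<Rightarrow> complex poly" where
  "phi_seq c4 c5 c6 \<phi> \<psi> 0 = \<phi>"
| "phi_seq c4 c5 c6 \<phi> \<psi> (Suc k) =
     Sx c4 c5 c6 (phi_seq c4 c5 c6 \<phi> \<psi> k)
     + U1 c4 * Sx c4 c5 c6 (psi_seq c4 c5 c6 \<phi> \<psi> k)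
     + U2 c4 c5 c6 * Dx c4 c5 c6 (psi_seq c4 c5 c6 \<phi> \<psi> k)"
| "psi_seq c4 c5 c6 \<phi> \<psi> 0 = \<psi>"
| "psi_seq c4 c5 c6 \<phi> \<psi> (Suc k) =
     Dx c4 c5 c6 (phi_seq c4 c5 c6 \<phi> \<psi> k)
     + Sx c4 c5 c6 (psi_seq c4 c5 c6 \<phi> \<psi> k)
     + U1 c4 * Dx c4 c5 c6 (psi_seq c4 c5 c6 \<phi> \<psi> k)"

primrec u_seq ::
  "complex \<Rightarrow> complex \<Rightarrow> complex \<Rightarrow> complex poly \<Rightarrow> complex poly \<Rightarrow> (complex poly \<Rightarrow> complex)
     \<Rightarrow> nat \<Rightarrow> complex poly \<Rightarrow> complex" where
  "u_seq c4 c5 c6 \<phi> \<psi> u 0 = u"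
| "u_seq c4 c5 c6 \<phi> \<psi> u (Suc k) =
     (\<lambda>f. Dx_dual c4 c5 c6
            (fun_mult (U2 c4 c5 c6 * psi_seq c4 c5 c6 \<phi> \<psi> k) (u_seq c4 c5 c6 \<phi> \<psi> u k)) f
        - Sx_dual c4 c5 c6
            (fun_mult (phi_seq c4 c5 c6 \<phi> \<psi> k) (u_seq c4 c5 c6 \<phi> \<psi> u k)) f)"

lemma quad_lattice_shift:
  "quad_lattice c4 c5 c6 (s + 1/2) = quad_lattice c4 c5 c6 s + c4/4 + (c4 * s + c5/2)"
  "quad_lattice c4 c5 c6 (s - 1/2) = quad_lattice c4 c5 c6 s + c4/4 - (c4 * s + c5/2)"
  by (simp_all add: quad_lattice_def power2_eq_square algebra_simps)

lemma quad_lattice_diff: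
  "quad_lattice c4 c5 c6 (s + 1/2) - quad_lattice c4 c5 c6 (s - 1/2) = 2 * (c4 * s + c5/2)"
  by (simp add: quad_lattice_shift)

lemma poly_U2:
  "poly (U2 c4 c5 c6) (quad_lattice c4 c5 c6 s) = (c4 * s + c5/2)^2"
  by (simp add: U2_def quad_lattice_def power2_eq_square algebra_simps)

lemma Dx_Sx_exist:
  fixes f :: "complex poly" and c4 c5 c6 :: complex
  defines "x \<equiv> quad_lattice c4 c5 c6"
  shows "\<exists>g h. \<forall>s.
    poly g (x s) * (x (s + 1/2) - x (s - 1/2)) = poly f (x (s + 1/2)) - poly f (x (s - 1/2)) \<and>
    poly h (x s) = (poly f (x (s + 1/2)) + poly f (x (s - 1/2))) / 2"
proof (induction f)
  case 0
  show ?case by (intro exI[of _ 0]) simp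
next
  case (pCons a f)
  then obtain g h where g:
      "\<And>s. poly g (x s) * (x (s + 1/2) - x (s - 1/2)) = poly f (x (s + 1/2)) - poly f (x (s - 1/2))"
    and h: "\<And>s. poly h (x s) = (poly f (x (s + 1/2)) + poly f (x (s - 1/2))) / 2"
    by blast
  define A where "A = [:c4/4, 1:]"
  show ?case
  proof (rule exI[of _ "h + A * g"], rule exI[of _ "[:a:] + A * h + U2 c4 c5 c6 * g"], rule allI)
    fix s
    define t X where "t = c4 * s + c5/2" and "X = x s + c4/4"
    have p: "x (s + 1/2) = X + t" "x (s - 1/2) = X - t"
      unfolding x_def t_def X_def by (rule quad_lattice_shift)+
    have A: "poly A (x s) = X" by (simp add: A_def X_def add.commute)
    have U: "poly (U2 c4 c5 c6) (x s) = t^2" unfolding x_def t_def by (rule poly_U2)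
    have gs: "2 * t * poly g (x s) = poly f (X + t) - poly f (X - t)"
      using g[of s] by (simp add: p algebra_simps)
    have hs: "2 * poly h (x s) = poly f (X + t) + poly f (X - t)"
      using h[of s] by (simp add: p mult.commute)
    have "poly (h + A * g) (x s) * (x (s + 1/2) - x (s - 1/2))
            = t * (2 * poly h (x s)) + X * (2 * t * poly g (x s))"
      by (simp add: p A algebra_simps)
    also have "\<dots> = (X + t) * poly f (X + t) - (X - t) * poly f (X - t)"
      unfolding gs hs by (simp add: algebra_simps)
    finally have 1: "poly (h + A * g) (x s) * (x (s + 1/2) - x (s - 1/2))
        = poly (pCons a f) (x (s + 1/2)) - poly (pCons a f) (x (s - 1/2))"
      by (simp add: p)
    have "2 * poly ([:a:] + A * h + U2 c4 c5 c6 * g) (x s)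
            = 2 * a + X * (2 * poly h (x s)) + t * (2 * t * poly g (x s))"
      by (simp add: A U power2_eq_square algebra_simps)
    also have "\<dots> = 2 * a + (X + t) * poly f (X + t) + (X - t) * poly f (X - t)"
      unfolding gs hs by (simp add: algebra_simps)
    finally have 2: "poly ([:a:] + A * h + U2 c4 c5 c6 * g) (x s)
        = (poly (pCons a f) (x (s + 1/2)) + poly (pCons a f) (x (s - 1/2))) / 2"
      by (simp add: p mult.commute)
    show "poly (h + A * g) (x s) * (x (s + 1/2) - x (s - 1/2))
        = poly (pCons a f) (x (s + 1/2)) - poly (pCons a f) (x (s - 1/2)) \<and>
      poly ([:a:] + A * h + U2 c4 c5 c6 * g) (x s)
        = (poly (pCons a f) (x (s + 1/2)) + poly (pCons a f) (x (s - 1/2))) / 2"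
      using 1 2 by blast
  qed
qed

lemma quad_lattice_poly_eqI:
  assumes "\<not> (c4 = 0 \<and> c5 = 0)"
    and eq: "\<And>s. quad_lattice c4 c5 c6 (s + 1/2) \<noteq> quad_lattice c4 c5 c6 (s - 1/2) \<Longrightarrow>
      poly g (quad_lattice c4 c5 c6 s) = poly h (quad_lattice c4 c5 c6 s)"
  shows "g = h"
proof -
  define q where "q = pcompose (g - h) [:c6, c5, c4:]"
  have x: "poly [:c6, c5, c4:] s = quad_lattice c4 c5 c6 s" for s
    by (simp add: quad_lattice_def power2_eq_square algebra_simps)
  have "poly (q * [:c5/2, c4:]) s = 0" for s
  proof (cases "c4 * s + c5/2 = 0")
    case False
    then have "quad_lattice c4 c5 c6 (s + 1/2) - quad_lattice c4 c5 c6 (s - 1/2) \<noteq> 0"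
      unfolding quad_lattice_diff mult_eq_0_iff by simp
    then have "poly (g - h) (quad_lattice c4 c5 c6 s) = 0"
      using eq[of s] by simp
    then show ?thesis
      unfolding q_def poly_mult poly_pcompose x by simp
  next
    case True
    then have "poly [:c5/2, c4:] s = 0" by (simp add: algebra_simps)
    then show ?thesis by (simp only: poly_mult mult_zero_right)
  qed
  then have "q * [:c5/2, c4:] = 0"
    using poly_all_0_iff_0 by blast
  then have "q = 0"
    using assms(1) by (metis div_0 divide_eq_0_iff mult_eq_0_iff pCons_eq_0_iff zero_neq_numeral)
  then have "g - h = 0"
    unfolding q_def by (rule pcompose_eq_0) (use assms(1) in auto)
  then show ?thesis by simp
qed

lemma Dx_ex1:
  fixes f :: "complex poly" and c4 c5 c6 :: complex
  defines "x \<equiv> quad_lattice c4 c5 c6"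
  assumes "\<not> (c4 = 0 \<and> c5 = 0)"
  shows "\<exists>!g. \<forall>s. x (s + 1/2) \<noteq> x (s - 1/2) \<longrightarrow>
           poly g (x s) = (poly f (x (s + 1/2)) - poly f (x (s - 1/2)))
                            / (x (s + 1/2) - x (s - 1/2))"
    (is "\<exists>!g. ?P g")
proof -
  obtain g where "\<And>s. poly g (x s) * (x (s + 1/2) - x (s - 1/2))
      = poly f (x (s + 1/2)) - poly f (x (s - 1/2))"
    using Dx_Sx_exist[of c4 c5 c6 f] unfolding x_def by blast
  then have "?P g" by (simp add: eq_divide_eq)
  moreover have "g' = h'" if "?P g'" "?P h'" for g' h'
    using quad_lattice_poly_eqI[OF assms(2), of c6 g' h'] that unfolding x_def by simp
  ultimately show ?thesis by blast
qed

lemma Sx_ex1: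
  fixes f :: "complex poly" and c4 c5 c6 :: complex
  defines "x \<equiv> quad_lattice c4 c5 c6"
  assumes "\<not> (c4 = 0 \<and> c5 = 0)"
  shows "\<exists>!g. \<forall>s. poly g (x s) = (poly f (x (s + 1/2)) + poly f (x (s - 1/2))) / 2"
    (is "\<exists>!g. ?P g")
proof -
  obtain g where "?P g"
    using Dx_Sx_exist[of c4 c5 c6 f] unfolding x_def by blast
  moreover have "g' = h'" if "?P g'" "?P h'" for g' h'
    using quad_lattice_poly_eqI[OF assms(2), of c6 g' h'] that unfolding x_def by simp
  ultimately show ?thesis by blast
qed

lemma vector_space_smult: "vector_space (smult :: complex \<Rightarrow> complex poly \<Rightarrow> complex poly)"
  by standard (auto simp: smult_add_right smult_add_left)

lemma poly_functional_iff:
  "poly_functional u \<longleftrightarrow>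
     (\<forall>f g. u (f + g) = u f + u g) \<and> (\<forall>r f. u (smult r f) = r * u f)"
proof -
  have "vector_space ((*) :: complex \<Rightarrow> complex \<Rightarrow> complex)"
    by standard (auto simp: algebra_simps)
  with vector_space_smult show ?thesis
    unfolding poly_functional_def Vector_Spaces.linear_iff by auto
qed

end

theory Submission
  imports Defs
begin

text \<open>
  Let \<open>S\<close> and \<open>D\<close> be the averaging and the difference operator and \<open>t = (x(s+1/2) - x(s-1/2))/2\<close>, so
  that \<open>t^2 = U2(x(s))\<close> and \<open>f \<mapsto> S f + t D f\<close> is a ring homomorphism. Define \<open>L\<close> and \<open>M\<close> by
  \<open>(\<phi> + t \<psi>)(S g + t D g) = M g + t L g\<close>. The functional equation says \<open>u \<circ> L = 0\<close>, and the derived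
  functional is \<open>u' = - u \<circ> M\<close>. The commutation rules of \<open>D\<close> and \<open>S\<close> give \<open>u'(g D f) = u(f L g)\<close> and the
  functional equation for \<open>u'\<close>. Iterating, \<open>u_n(D^n f) = u(f Q_n)\<close>, where \<open>u_n\<close> is the \<open>n\<close>-th derived
  functional and \<open>Q_n = L_0 L_1 \<dots> L_(n-1) 1\<close> has leading coefficient \<open>d_(n-1) \<dots> d_(2n-2)\<close>. Hence \<open>Q_n\<close>
  is orthogonal to all lower degrees and \<open>u(z^n Q_n) = n! u_n(1)\<close>; the functional equation of \<open>u_n\<close>
  tested on \<open>1\<close> and \<open>z\<close> expresses \<open>u_(n+1)(1)\<close> by \<open>u_n(1)\<close>.

  Since \<open>u(f L D g) = u'(D g D f)\<close> is symmetric, orthogonal polynomials are eigenfunctions: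
  \<open>L D P_n = n d_(n-1) P_n\<close>. The subleading coefficients of this identity give \<open>B_n\<close>. If \<open>u\<close> is regular and
  \<open>d_(n-1) = 0\<close>, then \<open>g = D P_n\<close> satisfies \<open>L g = 0\<close>, so \<open>0 = u(L (g h)) = u((M g) D h)\<close> for all \<open>h\<close>.
  Regularity yields \<open>M g = 0\<close>, thus \<open>(\<phi> + t \<psi>)(S g + t D g) = 0\<close>, which is impossible because
  \<open>(S g)^2 - U2 (D g)^2\<close> has degree \<open>2 deg g\<close>.
\<close>

section \<open>Orthogonal polynomial sequences\<close>

context
  fixes u :: "complex poly \<Rightarrow> complex"
  assumes u: "poly_functional u"
begin

lemma fun_add: "u (f + g) = u f + u g" and fun_smult: "u (smult r f) = r * u f"
  using u by (simp_all add: poly_functional_iff)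

lemma fun_0: "u 0 = 0"
  using fun_smult[of 0 0] by simp

lemma fun_minus: "u (- f) = - u f"
  using fun_smult[of "-1" f] by simp

lemma fun_diff: "u (f - g) = u f - u g"
  using fun_add[of f "- g"] fun_minus[of g] by simp

lemma fun_smult_poly: "u ([:r:] * f) = r * u f"
  by (simp add: fun_smult)

lemmas fun_simps = fun_add fun_smult fun_0 fun_minus fun_diff

lemma monic_OPS_D:
  assumes "is_monic_OPS u P"
  shows "is_OPS u P" "degree (P n) = n" "coeff (P n) n = 1" "u (P n * P n) \<noteq> 0"
proof -
  show "is_OPS u P" and deg: "degree (P n) = n"
    using assms by (simp_all add: is_monic_OPS_def is_OPS_def)
  have "lead_coeff (P n) = 1"
    using assms by (simp add: is_monic_OPS_def)
  then show "coeff (P n) n = 1" by (simp add: deg)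
  show "u (P n * P n) \<noteq> 0"
    using assms by (auto simp: is_monic_OPS_def is_OPS_def)
qed

lemma OPS_D:
  assumes "is_OPS u P"
  shows "degree (P n) = n" "coeff (P n) n \<noteq> 0" "u (P n * P n) \<noteq> 0"
proof -
  show deg: "degree (P n) = n" and h: "u (P n * P n) \<noteq> 0"
    using assms by (auto simp: is_OPS_def)
  have "P n \<noteq> 0" using h fun_0 by auto
  then show "coeff (P n) n \<noteq> 0" using deg leading_coeff_neq_0[of "P n"] by simp
qed

text \<open>Induction on \<open>m\<close>: subtracting a multiple of \<open>P m\<close> removes the
  top coefficient of \<open>f\<close>. Vanishing coefficients, instead of a bound on
  \<open>degree\<close>, let \<open>m = 0\<close> mean \<open>f = 0\<close>.\<close>

lemma OPS_orthogonal:
  assumes P: "is_OPS u P" and f: "\<And>i. i \<ge> m \<Longrightarrow> coeff f i = 0" and "m \<le> n"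
  shows "u (P n * f) = 0"
  using f \<open>m \<le> n\<close>
proof (induction m arbitrary: f)
  case 0
  then have "f = 0" by (simp add: poly_eq_iff)
  then show ?case by (simp add: fun_0)
next
  case (Suc m)
  have deg: "degree (P m) = m" and orth: "u (P n * P m) = 0"
    using P Suc.prems(2) by (auto simp: is_OPS_def)
  have lc: "coeff (P m) m \<noteq> 0"
    using OPS_D[OF P] by simp
  define r where "r = coeff f m / coeff (P m) m"
  have "coeff (f - smult r (P m)) i = 0" if "i \<ge> m" for i
    using that Suc.prems(1)[of i] lc deg
    by (cases "i = m") (auto simp: r_def coeff_eq_0)
  then have "u (P n * (f - smult r (P m))) = 0"
    using Suc.IH Suc.prems(2) by simp
  then show ?case
    using orth by (simp add: right_diff_distrib fun_simps)
qed

lemma monic_OPS_pairing: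
  assumes P: "is_monic_OPS u P" and f: "degree f \<le> n"
  shows "u (P n * f) = coeff f n * u (P n * P n)"
proof -
  have deg: "degree (P n) = n" and lc: "coeff (P n) n = 1"
    using monic_OPS_D[OF P] by simp_all
  have "coeff (f - smult (coeff f n) (P n)) i = 0" if "i \<ge> n" for i
    using that f deg lc by (cases "i = n") (auto simp: coeff_eq_0)
  then have "u (P n * (f - smult (coeff f n) (P n))) = 0"
    using OPS_orthogonal[OF monic_OPS_D(1)[OF P]] by blast
  then show ?thesis by (simp add: right_diff_distrib fun_simps)
qed

text \<open>If \<open>f\<close> had degree \<open>m < n\<close>, its pairing with \<open>P m\<close>
  would be a nonzero multiple of the nonzero norm of \<open>P m\<close>.\<close>

lemma OPS_nondegenerate:
  assumes P: "is_OPS u P"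
    and f: "\<And>k. k < n \<Longrightarrow> u (P k * f) = 0" "\<And>i. i \<ge> n \<Longrightarrow> coeff f i = 0"
  shows "f = 0"
proof (rule ccontr)
  assume "f \<noteq> 0"
  define m where "m = degree f"
  have m: "m < n" using f(2)[of m] \<open>f \<noteq> 0\<close> unfolding m_def
    by (cases "degree f < n") auto
  have deg: "degree (P m) = m" and h: "u (P m * P m) \<noteq> 0" and lc: "coeff (P m) m \<noteq> 0"
    using OPS_D[OF P] by simp_all
  define r where "r = coeff f m / coeff (P m) m"
  have "coeff (f - smult r (P m)) i = 0" if "i \<ge> m" for i
    using that lc deg by (cases "i = m") (auto simp: coeff_eq_0 m_def r_def)
  then have "u (P m * (f - smult r (P m))) = 0"
    using OPS_orthogonal[OF P] by blast
  then have "r * u (P m * P m) = 0"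
    using f(1)[OF m] by (simp add: right_diff_distrib fun_simps)
  then show False
    using h lc \<open>f \<noteq> 0\<close> by (auto simp: r_def m_def)
qed

lemma regular_annihilator:
  assumes "regular u" and "\<And>h. u (g * h) = 0"
  shows "g = 0"
proof -
  obtain P where "is_OPS u P" using assms(1) by (auto simp: regular_def)
  then show ?thesis
    by (rule OPS_nondegenerate[where n = "Suc (degree g)"])
      (use assms(2) in \<open>auto simp: mult.commute[of _ g] coeff_eq_0\<close>)
qed

lemma monic_OPS_unique:
  assumes P: "is_monic_OPS u P" and Q: "degree Q = n" "coeff Q n = 1"
    and orth: "\<And>f. (\<And>i. i \<ge> n \<Longrightarrow> coeff f i = 0) \<Longrightarrow> u (Q * f) = 0"
  shows "Q = P n"
proof -
  have PO: "is_OPS u P" and deg: "\<And>k. degree (P k) = k" and lc: "coeff (P n) n = 1"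
    using monic_OPS_D[OF P] by simp_all
  have "Q - P n = 0"
  proof (rule OPS_nondegenerate[OF PO, of n])
    fix k assume "k < n"
    then have "u (Q * P k) = 0" "u (P n * P k) = 0"
      using deg PO by (auto intro!: orth simp: coeff_eq_0 is_OPS_def)
    then show "u (P k * (Q - P n)) = 0"
      by (simp add: right_diff_distrib fun_simps mult.commute)
  next
    fix i assume "i \<ge> n"
    then show "coeff (Q - P n) i = 0"
      using Q deg[of n] lc by (cases "i = n") (auto simp: coeff_eq_0)
  qed
  then show ?thesis by simp
qed

lemma is_monic_OPS_I:
  assumes deg: "\<And>n. degree (P n) = n" and lc: "\<And>n. coeff (P n) n = 1"
    and orth: "\<And>n f. (\<And>i. i \<ge> n \<Longrightarrow> coeff f i = 0) \<Longrightarrow> u (P n * f) = 0"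
    and ne: "\<And>n. u (P n * P n) \<noteq> 0"
  shows "is_monic_OPS u P"
proof -
  define h where "h n = u (P n * P n)" for n
  have "u (P n * P k) = (if n = k then h n else 0)" for n k
  proof (cases n k rule: linorder_cases)
    case less
    then have "u (P k * P n) = 0" using deg by (intro orth) (simp add: coeff_eq_0)
    with less show ?thesis by (simp add: mult.commute)
  next
    case greater
    then have "u (P n * P k) = 0" using deg by (intro orth) (simp add: coeff_eq_0)
    with greater show ?thesis by simp
  qed (simp add: h_def)
  moreover have "h n \<noteq> 0" for n
    using ne by (simp add: h_def)
  ultimately show ?thesis
    unfolding is_monic_OPS_def is_OPS_def using deg lc by auto
qed

lemma regular_imp_monic_OPS:
  assumes "regular u"
  shows "\<exists>P. is_monic_OPS u P"
proof -
  obtain P where P: "is_OPS u P" using assms by (auto simp: regular_def)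
  have deg: "degree (P n) = n" and ne: "coeff (P n) n \<noteq> 0" for n
    using OPS_D[OF P] by simp_all
  define R where "R n = smult (inverse (coeff (P n) n)) (P n)" for n
  have "is_monic_OPS u R"
  proof (rule is_monic_OPS_I)
    show "degree (R n) = n" for n using ne[of n] deg by (simp add: R_def)
    show "coeff (R n) n = 1" for n using ne[of n] deg by (simp add: R_def)
    show "u (R n * f) = 0" if "\<And>i. i \<ge> n \<Longrightarrow> coeff f i = 0" for n f
      using OPS_orthogonal[OF P that, of n] by (simp add: R_def fun_simps)
    show "u (R n * R n) \<noteq> 0" for n
      using P ne[of n] by (auto simp: R_def fun_simps is_OPS_def)
  qed
  then show ?thesis by blast
qed

text \<open>The defect \<open>R\<close> has degree below \<open>n\<close> by monicity and the choice
  of \<open>B\<close>, and is orthogonal to \<open>P k\<close> for \<open>k < n\<close> by the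
  choice of \<open>C\<close>.\<close>

lemma monic_OPS_recurrence:
  assumes P: "is_monic_OPS u P"
    and B: "\<And>n. B n = (if n = 0 then 0 else coeff (P n) (n - 1)) - coeff (P (Suc n)) n"
    and C: "\<And>n. C (Suc n) = u (P (Suc n) * P (Suc n)) / u (P n * P n)"
  shows "P (Suc n) = [:- B n, 1:] * P n - (if n = 0 then 0 else smult (C n) (P (n - 1)))"
proof -
  have PO: "is_OPS u P" and deg: "\<And>k. degree (P k) = k" and lc: "\<And>n. coeff (P n) n = 1"
    using monic_OPS_D[OF P] by simp_all
  have h: "u (P k * P k) \<noteq> 0" for k using PO by (auto simp: is_OPS_def)
  define R where "R = P (Suc n) - [:- B n, 1:] * P n + (if n = 0 then 0 else smult (C n) (P (n - 1)))"
  have z: "coeff (P j) i = 0" if "j < i" for i j using that deg by (simp add: coeff_eq_0)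
  have "R = 0"
  proof (rule OPS_nondegenerate[OF PO, of n])
    fix i assume i: "i \<ge> n"
    then consider "i = n" | "i = Suc n" | "i > Suc n" by linarith
    then show "coeff R i = 0"
    proof cases
      case 1 then show ?thesis
        by (cases n) (auto simp: R_def B lc z)
    next
      case 2 then show ?thesis by (auto simp: R_def lc z)
    next
      case 3 then show ?thesis by (cases i) (auto simp: R_def z)
    qed
  next
    fix k assume k: "k < n"
    then obtain m where n: "n = Suc m" by (cases n) auto
    have 1: "u (P (Suc n) * P k) = 0" "u (P n * P k) = 0"
      using k PO by (auto simp: is_OPS_def)
    \<comment> \<open>\<open>pCons 0 (P k)\<close> is z times \<open>P k\<close>. The number
      \<open>coeff (P k) m\<close> is 1 for \<open>k = m\<close> and 0 for \<open>k < m\<close>, so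
      \<open>C\<close> only matters at \<open>k = m\<close>.\<close>
    have 2: "u (P n * pCons 0 (P k)) = coeff (P k) m * u (P n * P n)"
      using monic_OPS_pairing[OF P, of "pCons 0 (P k)" n] k n deg[of k]
      by (simp add: degree_pCons_le le_trans[OF degree_pCons_le])
    have 3: "u (P m * P k) = coeff (P k) m * u (P m * P m)"
      using monic_OPS_pairing[OF P, of "P k" m] k n deg[of k] by simp
    have "P k * R = P (Suc n) * P k + smult (B n) (P n * P k) - P n * pCons 0 (P k)
        + smult (C n) (P m * P k)"
      by (simp add: R_def n algebra_simps)
    then show "u (P k * R) = 0"
      using 1 2 3 h[of m] by (simp add: fun_simps C n)
  qed
  then show ?thesis by (simp add: R_def algebra_simps)
qed

end

section \<open>The operators of a quadratic lattice\<close>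

lemma Sx_Dx_constant_lattice: "c4 = 0 \<and> c5 = 0 \<Longrightarrow> Sx c4 c5 c6 f = f"
  "c4 = 0 \<and> c5 = 0 \<Longrightarrow> Dx c4 c5 c6 f = pderiv f"
  by (simp_all add: Sx_def Dx_def)

text \<open>Clearing the denominator extends the defining identity to the points where it vanishes,
  since both sides are 0 there.\<close>

lemma poly_Dx:
  assumes "\<not> (c4 = 0 \<and> c5 = 0)"
  shows "poly (Dx c4 c5 c6 f) (quad_lattice c4 c5 c6 s)
           * (quad_lattice c4 c5 c6 (s + 1/2) - quad_lattice c4 c5 c6 (s - 1/2))
         = poly f (quad_lattice c4 c5 c6 (s + 1/2)) - poly f (quad_lattice c4 c5 c6 (s - 1/2))"
proof (cases "quad_lattice c4 c5 c6 (s + 1/2) = quad_lattice c4 c5 c6 (s - 1/2)")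
  case False
  have "Dx c4 c5 c6 f = (THE g. \<forall>s.
      quad_lattice c4 c5 c6 (s + 1/2) \<noteq> quad_lattice c4 c5 c6 (s - 1/2) \<longrightarrow>
      poly g (quad_lattice c4 c5 c6 s)
        = (poly f (quad_lattice c4 c5 c6 (s + 1/2)) - poly f (quad_lattice c4 c5 c6 (s - 1/2)))
          / (quad_lattice c4 c5 c6 (s + 1/2) - quad_lattice c4 c5 c6 (s - 1/2)))"
    using assms by (simp only: Dx_def Let_def if_False)
  with theI'[OF Dx_ex1[OF assms, of c6 f]] False
  have "poly (Dx c4 c5 c6 f) (quad_lattice c4 c5 c6 s)
        = (poly f (quad_lattice c4 c5 c6 (s + 1/2)) - poly f (quad_lattice c4 c5 c6 (s - 1/2)))
          / (quad_lattice c4 c5 c6 (s + 1/2) - quad_lattice c4 c5 c6 (s - 1/2))"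
    by simp
  with False show ?thesis by simp
qed simp

lemma poly_Sx:
  assumes "\<not> (c4 = 0 \<and> c5 = 0)"
  shows "2 * poly (Sx c4 c5 c6 f) (quad_lattice c4 c5 c6 s)
         = poly f (quad_lattice c4 c5 c6 (s + 1/2)) + poly f (quad_lattice c4 c5 c6 (s - 1/2))"
proof -
  have "Sx c4 c5 c6 f = (THE g. \<forall>s. poly g (quad_lattice c4 c5 c6 s)
      = (poly f (quad_lattice c4 c5 c6 (s + 1/2)) + poly f (quad_lattice c4 c5 c6 (s - 1/2))) / 2)"
    using assms by (simp only: Sx_def Let_def if_False)
  with theI'[OF Sx_ex1[OF assms, of c6 f]]
  have "poly (Sx c4 c5 c6 f) (quad_lattice c4 c5 c6 s)
      = (poly f (quad_lattice c4 c5 c6 (s + 1/2)) + poly f (quad_lattice c4 c5 c6 (s - 1/2))) / 2"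
    by metis
  then show ?thesis by (simp add: mult.commute)
qed

text \<open>With X = x(s) + c4/4 and x(s +- 1/2) = X +- t this is the product rule for the factor z.
  It includes constant lattices, so the rules of the locale below follow by induction without
  distinguishing lattices.\<close>

lemma Dx_pCons:
  "Dx c4 c5 c6 (pCons r f) = Sx c4 c5 c6 f + [:c4/4, 1:] * Dx c4 c5 c6 f"
proof (cases "c4 = 0 \<and> c5 = 0")
  case True
  then show ?thesis by (simp add: Sx_Dx_constant_lattice pderiv_pCons)
next
  case False
  show ?thesis
  proof (rule quad_lattice_poly_eqI[OF False])
    fix s
    let ?x = "quad_lattice c4 c5 c6"
    assume ne: "?x (s + 1/2) \<noteq> ?x (s - 1/2)"
    define X t where "X = ?x s + c4/4" and "t = c4 * s + c5/2"
    have p: "?x (s + 1/2) = X + t" "?x (s - 1/2) = X - t"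
      unfolding X_def t_def by (rule quad_lattice_shift)+
    have A: "poly [:c4/4, 1:] (?x s) = X" by (simp add: X_def add.commute)
    have "2 * t * poly (Dx c4 c5 c6 (pCons r f)) (?x s)
        = 2 * t * poly (Sx c4 c5 c6 f + [:c4/4, 1:] * Dx c4 c5 c6 f) (?x s)"
      using poly_Dx[OF False, of c6 "pCons r f" s] poly_Dx[OF False, of c6 f s]
        poly_Sx[OF False, of c6 f s]
      unfolding p poly_add poly_mult A unfolding poly_pCons by algebra
    moreover have "2 * t \<noteq> 0" using ne unfolding p by auto
    ultimately show "poly (Dx c4 c5 c6 (pCons r f)) (?x s)
        = poly (Sx c4 c5 c6 f + [:c4/4, 1:] * Dx c4 c5 c6 f) (?x s)"
      by (simp only: mult_left_cancel simp_thms)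
  qed
qed

lemma Sx_pCons:
  "Sx c4 c5 c6 (pCons r f)
     = [:r:] + [:c4/4, 1:] * Sx c4 c5 c6 f + U2 c4 c5 c6 * Dx c4 c5 c6 f"
proof (cases "c4 = 0 \<and> c5 = 0")
  case True
  then show ?thesis by (simp add: Sx_Dx_constant_lattice U2_def)
next
  case False
  show ?thesis
  proof (rule quad_lattice_poly_eqI[OF False])
    fix s
    let ?x = "quad_lattice c4 c5 c6"
    define X t where "X = ?x s + c4/4" and "t = c4 * s + c5/2"
    have p: "?x (s + 1/2) = X + t" "?x (s - 1/2) = X - t"
      unfolding X_def t_def by (rule quad_lattice_shift)+
    have U: "poly (U2 c4 c5 c6) (?x s) = t^2" unfolding t_def by (rule poly_U2)
    have A: "poly [:c4/4, 1:] (?x s) = X" by (simp add: X_def add.commute)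
    have "2 * poly (Sx c4 c5 c6 (pCons r f)) (?x s)
        = 2 * poly ([:r:] + [:c4/4, 1:] * Sx c4 c5 c6 f + U2 c4 c5 c6 * Dx c4 c5 c6 f) (?x s)"
      using poly_Sx[OF False, of c6 "pCons r f" s] poly_Dx[OF False, of c6 f s]
        poly_Sx[OF False, of c6 f s]
      unfolding p poly_add poly_mult A U unfolding poly_pCons poly_0 by algebra
    then show "poly (Sx c4 c5 c6 (pCons r f)) (?x s)
        = poly ([:r:] + [:c4/4, 1:] * Sx c4 c5 c6 f + U2 c4 c5 c6 * Dx c4 c5 c6 f) (?x s)"
      by (simp only: mult_left_cancel simp_thms zero_neq_numeral[symmetric] not_False_eq_True)
  qed
qed

lemma Dx_0 [simp]: "Dx c4 c5 c6 0 = 0" and Sx_0 [simp]: "Sx c4 c5 c6 0 = 0"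
proof -
  show "Dx c4 c5 c6 0 = 0"
  proof (cases "c4 = 0 \<and> c5 = 0")
    case False
    show ?thesis
      by (rule quad_lattice_poly_eqI[OF False, of c6])
        (use poly_Dx[OF False, of c6 0] in auto)
  qed (simp add: Sx_Dx_constant_lattice)
  show "Sx c4 c5 c6 0 = 0"
  proof (cases "c4 = 0 \<and> c5 = 0")
    case False
    show ?thesis
      by (rule quad_lattice_poly_eqI[OF False, of c6])
        (use poly_Sx[OF False, of c6 0] in auto)
  qed (simp add: Sx_Dx_constant_lattice)
qed

section \<open>Product and commutation rules of the difference and averaging operators\<close>

locale quadratic_lattice =
  fixes c4 c5 c6 :: complex
begin

abbreviation D where "D \<equiv> Dx c4 c5 c6"
abbreviation S where "S \<equiv> Sx c4 c5 c6"
abbreviation V where "V \<equiv> U2 c4 c5 c6"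
abbreviation W where "W \<equiv> U1 c4"

lemma V_eq: "V = [:c5^2/4 - c4 * c6, c4:]"
  by (simp add: U2_def)

lemma D_const [simp]: "D [:r:] = 0" and S_const [simp]: "S [:r:] = [:r:]"
  by (simp_all add: Dx_pCons Sx_pCons)

lemma D_1 [simp]: "D 1 = 0" and S_1 [simp]: "S 1 = 1"
  by (simp_all add: one_pCons)

lemma D_add: "D (f + g) = D f + D g" and S_add: "S (f + g) = S f + S g"
proof (induction f arbitrary: g)
  case (pCons r f)
  {
    case (1 g)
    obtain s g' where g: "g = pCons s g'" by (cases g)
    show ?case
      using pCons.IH[of g'] by (simp add: g Dx_pCons algebra_simps)
  next
    case (2 g)
    obtain s g' where g: "g = pCons s g'" by (cases g)
    show ?case
      using pCons.IH[of g'] by (simp add: g Sx_pCons algebra_simps)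
  }
qed simp_all

lemma D_smult: "D (smult r f) = smult r (D f)" and S_smult: "S (smult r f) = smult r (S f)"
  by (induction f) (simp_all add: Dx_pCons Sx_pCons smult_add_right algebra_simps)

text \<open>The two components of the multiplicativity of f -> S f + t D f with t^2 =
  \<open>V\<close>; the induction is joint because both recursions mix the operators.\<close>

lemma D_mult: "D (f * g) = D f * S g + S f * D g"
  and S_mult: "S (f * g) = V * D f * D g + S f * S g"
proof (induction f)
  case (pCons r f)
  {
    case 1
    have "D (pCons r f * g) = smult r (D g) + D (pCons 0 (f * g))"
      by (simp add: D_add D_smult)
    then show ?case
      by (simp add: Dx_pCons Sx_pCons pCons.IH distrib_left distrib_right)
  next
    case 2
    have "S (pCons r f * g) = smult r (S g) + S (pCons 0 (f * g))"
      by (simp add: S_add S_smult)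
    then show ?case
      by (simp add: Dx_pCons Sx_pCons pCons.IH distrib_left distrib_right)
  }
qed simp_all

lemma D_W [simp]: "D W = 0" and S_W [simp]: "S W = W"
  by (simp_all add: U1_def)

lemma D_V: "D V = 2 * W" and S_V: "S V = V + W^2"
  by (simp_all add: V_eq U1_def Dx_pCons Sx_pCons numeral_poly power2_eq_square)

lemma D_S: "D (S f) = S (D f) + W * D (D f)"
  and S_S: "S (S f) = W * S (D f) + V * D (D f) + f"
proof (induction f)
  case (pCons r f)
  have Z: "D [:c4/4, 1:] = 1" "S [:c4/4, 1:] = [:c4/4, 1:] + [:c4/4:]"
    by (simp_all add: Dx_pCons Sx_pCons)
  have W: "W = 2 * [:c4/4:]" by (simp add: U1_def numeral_poly)
  \<comment> \<open>\<open>algebra\<close> treats \<open>[:c4/4, 1:]\<close> as an atom, so the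
    factor z hidden in \<open>pCons\<close> is rewritten as this atom minus c4/4.\<close>
  have f: "pCons r f = [:r:] + ([:c4/4, 1:] - [:c4/4:]) * f" by simp
  {
    case 1 show ?case
      unfolding Dx_pCons[of _ _ _ r f] Sx_pCons[of _ _ _ r f] D_add S_add D_mult S_mult Z
        D_V S_V D_const S_const pCons.IH
      unfolding W by algebra
  next
    case 2 show ?case
      unfolding Dx_pCons[of _ _ _ r f] Sx_pCons[of _ _ _ r f] D_add S_add D_mult S_mult Z
        D_V S_V D_const S_const pCons.IH
      unfolding W f by algebra
  }
qed simp_all

section \<open>Top coefficients, surjectivity and iterates of the operators\<close>

lemma coeff_D_pCons:
  "coeff (D (pCons r f)) n
     = coeff (S f) n + c4/4 * coeff (D f) n + (if n = 0 then 0 else coeff (D f) (n - 1))"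
  by (cases n) (simp_all add: Dx_pCons)

lemma coeff_S_pCons:
  "coeff (S (pCons r f)) n = (if n = 0 then r else 0)
     + c4/4 * coeff (S f) n + (if n = 0 then 0 else coeff (S f) (n - 1))
     + (c5^2/4 - c4 * c6) * coeff (D f) n + (if n = 0 then 0 else c4 * coeff (D f) (n - 1))"
  by (cases n) (simp_all add: Sx_pCons V_eq)

lemma coeff_D_S_top:
  assumes "degree f \<le> n"
  shows "(\<forall>i\<ge>n. coeff (D f) i = 0) \<and> (\<forall>i>n. coeff (S f) i = 0) \<and> coeff (S f) n = coeff f n
     \<and> (n > 0 \<longrightarrow> coeff (D f) (n - 1) = of_nat n * coeff f n)"
  using assms
proof (induction f arbitrary: n)
  case (pCons r f)
  show ?case
  proof (cases n)
    case 0
    then have "f = 0" using pCons.prems by (cases "f = 0") auto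
    then show ?thesis using 0 by (auto simp: coeff_pCons split: nat.split)
  next
    case (Suc m)
    then have "degree f \<le> m" using pCons.prems by (cases "f = 0") auto
    note IH = pCons.IH[OF this]
    show ?thesis
      using IH Suc by (cases m) (auto simp: coeff_D_pCons coeff_S_pCons algebra_simps)
  qed
qed simp

lemma degree_D: "degree f \<le> n \<Longrightarrow> degree (D f) \<le> n - 1"
  and degree_S: "degree f \<le> n \<Longrightarrow> degree (S f) \<le> n"
  using coeff_D_S_top[of f n] by (auto intro!: degree_le)

lemma coeff_D_ge: "degree f \<le> i \<Longrightarrow> coeff (D f) i = 0"
  and coeff_S_gt: "degree f < i \<Longrightarrow> coeff (S f) i = 0"
  using coeff_D_S_top[of f i] coeff_D_S_top[of f "i - 1"] by auto

lemma coeff_S_top: "degree f \<le> n \<Longrightarrow> coeff (S f) n = coeff f n"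
  and coeff_D_top: "degree f \<le> Suc n \<Longrightarrow> coeff (D f) n = of_nat (Suc n) * coeff f (Suc n)"
  using coeff_D_S_top[of f n] coeff_D_S_top[of f "Suc n"] by auto

text \<open>The constants come from z^m: with X = z + c4/4, S z^m = X^m + binom(m,2) X^(m-2) V + ...
  and D z^m = m X^(m-1) + binom(m,3) X^(m-3) V + ..., where V counts as c4 z to this order.\<close>

lemma coeff_D_S_second:
  "(degree f \<le> Suc n \<longrightarrow> coeff (S f) n
      = coeff f n + c4/4 * of_nat (Suc n) * of_nat (2 * n + 1) * coeff f (Suc n))
   \<and> (degree f \<le> Suc (Suc n) \<longrightarrow> coeff (D f) n = of_nat (Suc n) * coeff f (Suc n)
      + c4/12 * of_nat (Suc (Suc n)) * of_nat (Suc n) * of_nat (2 * n + 3) * coeff f (Suc (Suc n)))"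
proof (induction f arbitrary: n)
  case (pCons r f)
  show ?case
  proof (intro conjI impI)
    assume "degree (pCons r f) \<le> Suc n"
    then have deg: "degree f \<le> n" by (cases "f = 0") auto
    show "coeff (S (pCons r f)) n = coeff (pCons r f) n
        + c4/4 * of_nat (Suc n) * of_nat (2 * n + 1) * coeff (pCons r f) (Suc n)"
    proof (cases n)
      case 0
      then show ?thesis
        using deg by (simp add: coeff_S_pCons coeff_S_top coeff_D_ge)
    next
      case (Suc m)
      then show ?thesis
        using deg pCons.IH[of m]
        by (simp add: coeff_S_pCons coeff_S_top coeff_D_ge coeff_D_top) (simp add: algebra_simps)
    qed
  next
    assume "degree (pCons r f) \<le> Suc (Suc n)"
    then have deg: "degree f \<le> Suc n" by (cases "f = 0") auto
    show "coeff (D (pCons r f)) n = of_nat (Suc n) * coeff (pCons r f) (Suc n)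
      + c4/12 * of_nat (Suc (Suc n)) * of_nat (Suc n) * of_nat (2 * n + 3)
          * coeff (pCons r f) (Suc (Suc n))"
    proof (cases n)
      case 0
      then show ?thesis
        using deg pCons.IH[of 0] by (simp add: coeff_D_pCons coeff_D_top)
    next
      case (Suc m)
      then show ?thesis
        using deg pCons.IH[of m] pCons.IH[of n]
        by (simp add: coeff_D_pCons coeff_D_top) (simp add: field_simps)
    qed
  qed
qed simp

lemmas coeff_S_second = coeff_D_S_second[THEN conjunct1, THEN mp]
lemmas coeff_D_second = coeff_D_S_second[THEN conjunct2, THEN mp]

text \<open>D lowers the degree of a nonconstant polynomial by exactly one, so the image of a
  monomial cancels the top coefficient of \<open>f\<close>.\<close>

lemma D_surj: "\<exists>h. D h = f"
proof -
  have "\<exists>h. D h = f" if "\<And>i. i \<ge> n \<Longrightarrow> coeff f i = 0" for n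
    using that
  proof (induction n arbitrary: f)
    case 0
    then have "f = 0" by (simp add: poly_eq_iff)
    then show ?case by (intro exI[of _ 0]) simp
  next
    case (Suc n)
    define q where "q = monom (coeff f n / of_nat (Suc n)) (Suc n)"
    have q: "degree q \<le> Suc n" by (simp add: q_def degree_monom_le)
    have "of_nat (Suc n) * coeff q (Suc n) = coeff f n"
      by (simp add: q_def del: of_nat_Suc)
    then have "coeff (f - D q) i = 0" if "i \<ge> n" for i
      using that Suc.prems[of i] q
      by (cases "i = n") (auto simp: coeff_D_top coeff_D_ge coeff_eq_0 simp del: of_nat_Suc)
    then obtain h where "D h = f - D q" using Suc.IH by blast
    then have "D (h + q) = f" by (simp add: D_add)
    then show ?case by blast
  qed
  from this[of "Suc (degree f)"] show ?thesis by (simp add: coeff_eq_0)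
qed

lemma D_funpow:
  assumes "degree f \<le> n"
  shows "(D ^^ n) f = [:fact n * coeff f n:]"
  using assms
proof (induction n arbitrary: f)
  case 0
  then show ?case by (metis degree_0_id fact_0 funpow_0 le_zero_eq mult_1)
next
  case (Suc n)
  then have "degree (D f) \<le> n" using degree_D[of f "Suc n"] by simp
  then show ?case
    using Suc by (simp add: funpow_Suc_right coeff_D_top algebra_simps del: funpow.simps)
qed

text \<open>This is (S g + t D g)(S g - t D g). For g of degree m the first product has degree 2m,
  while a nonzero second one has degree at most 1 + 2(m - 1).\<close>

lemma norm_nonzero:
  assumes "g \<noteq> 0"
  shows "S g * S g - V * (D g * D g) \<noteq> 0"
proof
  assume eq: "S g * S g - V * (D g * D g) = 0"
  define m where "m = degree g"
  have lc: "coeff (S g) m \<noteq> 0" using assms by (simp add: coeff_S_top m_def)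
  then have deg: "degree (S g) = m"
    using degree_S[of g m] le_degree[of "S g" m] by (simp add: m_def)
  have "S g \<noteq> 0" using lc by auto
  then have D: "D g \<noteq> 0" "V \<noteq> 0" using eq by auto
  then have "m > 0" using coeff_D_ge[of g] by (cases "m = 0") (auto simp: m_def poly_eq_iff)
  moreover have "degree (S g * S g) = 2 * m"
    using \<open>S g \<noteq> 0\<close> deg by (simp add: degree_mult_eq)
  moreover have "degree (V * (D g * D g)) = degree V + 2 * degree (D g)"
    using D by (simp add: degree_mult_eq)
  moreover have "degree V \<le> 1" by (simp add: V_eq)
  moreover have "degree (D g) \<le> m - 1" using degree_D[of g m] by (simp add: m_def)
  ultimately show False using eq by simp
qed

section \<open>The tower of derived functionals\<close>

definition L :: "complex poly \<Rightarrow> complex poly \<Rightarrow> complex poly \<Rightarrow> complex poly"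
  where "L \<phi> \<psi> g = \<phi> * D g + \<psi> * S g"

definition M :: "complex poly \<Rightarrow> complex poly \<Rightarrow> complex poly \<Rightarrow> complex poly"
  where "M \<phi> \<psi> g = \<phi> * S g + V * \<psi> * D g"

lemma L_0: "L \<phi> \<psi> 0 = 0"
  by (simp add: L_def)

lemma M_add: "M \<phi> \<psi> (f + g) = M \<phi> \<psi> f + M \<phi> \<psi> g"
  and M_smult: "M \<phi> \<psi> (smult r f) = smult r (M \<phi> \<psi> f)"
  by (simp_all add: M_def D_add S_add D_smult S_smult smult_add_right algebra_simps)

text \<open>The source of adjointness: a functional u with u o L = 0 kills the right side, so -u o M
  at \<open>g * D f\<close> equals u at f L g.\<close>

lemma M_L_D:
  "M \<phi> \<psi> (g * D f) + f * L \<phi> \<psi> g = L \<phi> \<psi> (S f * g + (- W) * (g * D f))"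
proof -
  have "D (- W) = 0" "S (- W) = - W"
    using D_smult[of "-1" W] S_smult[of "-1" W] by simp_all
  then show ?thesis
    unfolding L_def M_def D_add S_add D_mult S_mult D_S S_S by algebra
qed

text \<open>Evaluates -u o M, modulo the range of L, on the part of the next functional equation
  that contains psi.\<close>

lemma M_S_WD:
  "M \<phi> \<psi> (S f + W * D f) = \<phi> * f + L \<phi> \<psi> (V * D f + (- (W^2)) * D f)"
proof -
  have W: "W^2 = [:(c4/2)^2:]" by (simp add: U1_def power2_eq_square)
  have "D (- (W^2)) = 0" "S (- (W^2)) = - (W^2)"
    unfolding W by simp_all
  then show ?thesis
    unfolding L_def M_def D_add S_add D_mult S_mult D_S S_S D_V S_V D_W S_W by algebra
qed

lemma L_eq_0_imp_eq_0:
  assumes u: "poly_functional u" and pearson: "\<And>f. u (L \<phi> \<psi> f) = 0"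
    and reg: "regular u" and ne: "(\<phi>, \<psi>) \<noteq> (0, 0)" and Lg: "L \<phi> \<psi> g = 0"
  shows "g = 0"
proof (rule ccontr)
  assume "g \<noteq> 0"
  have "u (M \<phi> \<psi> g * D h) = 0" for h
  proof -
    have "L \<phi> \<psi> (g * h) = L \<phi> \<psi> g * S h + M \<phi> \<psi> g * D h"
      unfolding L_def M_def D_mult S_mult by algebra
    then show ?thesis using pearson[of "g * h"] Lg by simp
  qed
  then have "u (M \<phi> \<psi> g * h) = 0" for h
    using D_surj[of h] by metis
  then have Mg: "M \<phi> \<psi> g = 0"
    by (rule regular_annihilator[OF u reg])
  \<comment> \<open>Multiplying (phi + t psi)(S g + t D g) = 0 by S g - t D g leaves (phi + t psi)
    times the norm \<open>?N\<close>; the identities are the two components.\<close>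
  let ?N = "S g * S g - V * (D g * D g)"
  have "\<phi> * ?N = S g * M \<phi> \<psi> g - V * D g * L \<phi> \<psi> g"
    "\<psi> * ?N = S g * L \<phi> \<psi> g - D g * M \<phi> \<psi> g"
    unfolding L_def M_def by algebra+
  then have "\<phi> * ?N = 0" "\<psi> * ?N = 0" by (simp_all add: Lg Mg)
  then show False using norm_nonzero[OF \<open>g \<noteq> 0\<close>] ne by auto
qed

lemma derived_functional:
  fixes \<phi> \<psi> :: "complex poly"
  defines "\<phi>' \<equiv> S \<phi> + W * S \<psi> + V * D \<psi>" and "\<psi>' \<equiv> D \<phi> + S \<psi> + W * D \<psi>"
  assumes u: "poly_functional u" and pearson: "\<And>f. u (L \<phi> \<psi> f) = 0"
    and v: "\<And>f. v f = - u (M \<phi> \<psi> f)"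
  shows "poly_functional v"
    and "v (g * D f) = u (f * L \<phi> \<psi> g)"
    and "v (L \<phi>' \<psi>' f) = 0"
proof -
  note us = fun_simps[OF u]
  show lin: "poly_functional v"
    by (simp add: poly_functional_iff v M_add M_smult us)
  have key: "v (g * D f) = u (f * L \<phi> \<psi> g)" for f g
    using M_L_D[of \<phi> \<psi> g f] pearson[of "S f * g + (- W) * (g * D f)"]
    by (metis add.inverse_inverse add_eq_0_iff us(1) v)
  then show "v (g * D f) = u (f * L \<phi> \<psi> g)" .
  \<comment> \<open>By the product rules L phi' psi' f splits into D (phi f) and S (psi f) + W D
    (psi f); \<open>v\<close> takes opposite values on these summands.\<close>
  have "v (D (\<phi> * f)) = u (\<phi> * f * \<psi>)"
    using key[of 1 "\<phi> * f"] by (simp add: L_def)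
  moreover have "v (S (\<psi> * f) + W * D (\<psi> * f)) = - u (\<phi> * (\<psi> * f))"
    unfolding v M_S_WD us pearson by simp
  moreover have "L \<phi>' \<psi>' f = D (\<phi> * f) + (S (\<psi> * f) + W * D (\<psi> * f))"
    unfolding L_def \<phi>'_def \<psi>'_def D_mult S_mult by algebra
  ultimately show "v (L \<phi>' \<psi>' f) = 0"
    by (simp add: fun_add[OF lin] mult_ac)
qed

end

section \<open>Iterated adjointness and Rodrigues polynomials\<close>

locale pearson_functional = quadratic_lattice +
  fixes \<phi> \<psi> :: "complex poly" and u :: "complex poly \<Rightarrow> complex"
  assumes u: "poly_functional u" and pearson: "u (L \<phi> \<psi> f) = 0"
begin

abbreviation "\<phi>\<^sub>s \<equiv> phi_seq c4 c5 c6 \<phi> \<psi>"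
abbreviation "\<psi>\<^sub>s \<equiv> psi_seq c4 c5 c6 \<phi> \<psi>"
abbreviation "u\<^sub>s \<equiv> u_seq c4 c5 c6 \<phi> \<psi> u"

lemma pearson_seq: "poly_functional (u\<^sub>s k) \<and> (\<forall>f. u\<^sub>s k (L (\<phi>\<^sub>s k) (\<psi>\<^sub>s k) f) = 0)"
  and u_seq_Suc_M: "u\<^sub>s (Suc k) f = - u\<^sub>s k (M (\<phi>\<^sub>s k) (\<psi>\<^sub>s k) f)"
proof -
  \<comment> \<open>The recursion turns into -u_k o M only by additivity of u_k, so linearity is
    carried through the induction.\<close>
  have step: "u\<^sub>s (Suc k) f = - u\<^sub>s k (M (\<phi>\<^sub>s k) (\<psi>\<^sub>s k) f)" if "poly_functional (u\<^sub>s k)" for k f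
    by (simp add: M_def Dx_dual_def Sx_dual_def fun_mult_def fun_simps[OF that] mult_ac
        del: phi_seq.simps psi_seq.simps)
  show *: "poly_functional (u\<^sub>s k) \<and> (\<forall>f. u\<^sub>s k (L (\<phi>\<^sub>s k) (\<psi>\<^sub>s k) f) = 0)" for k
  proof (induction k)
    case 0
    then show ?case using u pearson by simp
  next
    case (Suc k)
    then have lin: "poly_functional (u\<^sub>s k)"
      and pe: "\<And>f. u\<^sub>s k (L (\<phi>\<^sub>s k) (\<psi>\<^sub>s k) f) = 0" by blast+
    show ?case
      using derived_functional(1,3)[OF lin pe step[OF lin]] by (simp del: u_seq.simps)
  qed
  show "u\<^sub>s (Suc k) f = - u\<^sub>s k (M (\<phi>\<^sub>s k) (\<psi>\<^sub>s k) f)"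
    using step * by blast
qed

lemma u_seq_adjoint: "u\<^sub>s (Suc k) (g * D f) = u\<^sub>s k (f * L (\<phi>\<^sub>s k) (\<psi>\<^sub>s k) g)"
  by (rule derived_functional(2)[where u = "u\<^sub>s k" and v = "u\<^sub>s (Suc k)"])
    (use pearson_seq[of k] u_seq_Suc_M[of k] in blast)+

text \<open>This is L_k L_(k+1) ... L_(k+n-1) 1. The level \<open>k\<close> is free because
  stripping L_k moves one level up; Q_n is the case \<open>k = 0\<close>.\<close>

primrec rodrigues_poly :: "nat \<Rightarrow> nat \<Rightarrow> complex poly" where
  "rodrigues_poly 0 k = 1"
| "rodrigues_poly (Suc n) k = L (\<phi>\<^sub>s k) (\<psi>\<^sub>s k) (rodrigues_poly n (Suc k))"

lemma rodrigues: "u\<^sub>s (k + n) ((D ^^ n) f) = u\<^sub>s k (f * rodrigues_poly n k)"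
proof (induction n arbitrary: k f)
  case (Suc n)
  have "u\<^sub>s (k + Suc n) ((D ^^ Suc n) f) = u\<^sub>s (Suc k) (rodrigues_poly n (Suc k) * D f)"
    using Suc.IH[of "Suc k" "D f"]
    by (simp add: funpow_Suc_right mult.commute del: funpow.simps u_seq.simps)
  then show ?case by (simp add: u_seq_adjoint del: u_seq.simps)
qed simp

lemma Dx_dual_funpow: "(Dx_dual c4 c5 c6 ^^ n) v f = (- 1) ^ n * v ((D ^^ n) f)"
proof (induction n arbitrary: f)
  case (Suc n)
  have "(Dx_dual c4 c5 c6 ^^ Suc n) v f = - (Dx_dual c4 c5 c6 ^^ n) v (D f)"
    by (simp add: Dx_dual_def)
  with Suc.IH show ?case by (simp add: funpow_Suc_right del: funpow.simps)
qed simp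

lemma bochner_symmetric: "u (f * L \<phi> \<psi> (D g)) = u (g * L \<phi> \<psi> (D f))"
  using u_seq_adjoint[of 0 "D g" f] u_seq_adjoint[of 0 "D f" g]
  by (simp add: mult.commute[of "D f"] del: u_seq.simps(2))

end

section \<open>Regularity and the recurrence coefficients\<close>

locale quadratic_pearson = quadratic_lattice +
  fixes a b c d e :: complex and u :: "complex poly \<Rightarrow> complex"
  assumes lin: "poly_functional u" and pe: "u (L [:c, b, a:] [:e, d:] f) = 0"
begin

sublocale pearson_functional c4 c5 c6 "[:c, b, a:]" "[:e, d:]" u
  by unfold_locales (fact lin, fact pe)

section \<open>Explicit coefficients of the tower and of the operators L and L D\<close>

definition dd :: "nat \<Rightarrow> complex" where "dd n = a * of_nat n + d"
definition ee :: "nat \<Rightarrow> complex" where "ee n = b * of_nat n + e + c4/2 * d * of_nat n ^ 2"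

text \<open>With beta = c4/4 the factors c4/2, 3/2 c4 and 4 c4 are 2 beta, 6 beta and 16 beta. Each
  step mixes the two sequences, so both forms are proved together.\<close>

lemma phi_psi_seq:
  "\<phi>\<^sub>s n = [:poly [:c, b, a:] (c4/4 * of_nat n ^ 2)
           + c4/2 * of_nat n * poly [:e, d:] (c4/4 * of_nat n ^ 2)
           - of_nat n / 4 * (4 * c4 * c6 - c5^2) * dd n, b + 3/2 * c4 * of_nat n * dd n, a:]
   \<and> \<psi>\<^sub>s n = [:ee n + c4/4 * of_nat n ^ 2 * dd (2 * n), dd (2 * n):]"
proof (induction n)
  case 0
  then show ?case by (simp add: dd_def ee_def)
next
  case (Suc n)
  then show ?case
    by (simp add: Dx_pCons Sx_pCons V_eq U1_def dd_def ee_def)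
      (simp add: field_simps power2_eq_square)
qed

lemma L_top:
  assumes g: "degree g \<le> n"
  shows "degree (L [:c', b', r:] [:e', s:] g) \<le> Suc n"
    and "coeff (L [:c', b', r:] [:e', s:] g) (Suc n) = (r * of_nat n + s) * coeff g n"
proof -
  show "degree (L [:c', b', r:] [:e', s:] g) \<le> Suc n"
  proof (rule degree_le, intro allI impI)
    fix i assume "Suc n < i"
    define j where "j = i - 2"
    have "i = Suc (Suc j)" "n \<le> j" using \<open>Suc n < i\<close> by (simp_all add: j_def)
    then show "coeff (L [:c', b', r:] [:e', s:] g) i = 0"
      using g by (simp add: L_def coeff_D_ge coeff_S_gt)
  qed
  show "coeff (L [:c', b', r:] [:e', s:] g) (Suc n) = (r * of_nat n + s) * coeff g n"
    using g by (cases n) (simp_all add: L_def coeff_D_ge coeff_S_gt coeff_S_top coeff_D_top algebra_simps)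
qed

lemma L_second:
  assumes g: "degree g \<le> n"
  shows "coeff (L [:c, b, a:] [:e, d:] g) n
    = (b * of_nat n + e + d * (c4/4 * of_nat n * (2 * of_nat n - 1))
        + a * (c4/12 * of_nat n * (of_nat n - 1) * (2 * of_nat n - 1))) * coeff g n
      + (if n = 0 then 0 else dd (n - 1) * coeff g (n - 1))"
proof -
  consider "n = 0" | "n = 1" | m where "n = Suc (Suc m)" by (metis One_nat_def not0_implies_Suc)
  then show ?thesis
  proof cases
    case 1
    then show ?thesis using g by (simp add: L_def coeff_D_ge coeff_S_top)
  next
    case 2
    then show ?thesis
      using g by (simp add: L_def dd_def coeff_D_ge coeff_S_top coeff_D_top coeff_S_second)
        (simp add: algebra_simps)
  next
    case (3 m)
    then have "degree g \<le> Suc (Suc m)" using g by simp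
    then show ?thesis
      using 3 by (simp add: L_def dd_def coeff_D_ge coeff_S_top coeff_D_top coeff_S_second coeff_D_second)
        (simp add: field_simps)
  qed
qed

lemma bochner_top:
  assumes f: "degree f \<le> Suc n"
  shows "degree (L [:c, b, a:] [:e, d:] (D f)) \<le> Suc n"
    and "coeff (L [:c, b, a:] [:e, d:] (D f)) (Suc n) = of_nat (Suc n) * dd n * coeff f (Suc n)"
  using L_top[of "D f" n] degree_D[OF f] coeff_D_top[OF f] by (simp_all add: dd_def)

text \<open>In the monomial basis L D is triangular; this adds the entry next to the diagonal,
  grouped so that \<open>dd (2 * n)\<close>, the difference of consecutive eigenvalues, is
  visible.\<close>

lemma bochner_second:
  assumes f: "degree f \<le> Suc n"
  shows "coeff (L [:c, b, a:] [:e, d:] (D f)) n = of_nat n * dd (n - 1) * coeff f n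
    + (of_nat (Suc n) * ee n + c4/6 * of_nat (Suc n) * of_nat n * (of_nat n - 1) * dd (2 * n))
      * coeff f (Suc n)"
proof (cases n)
  case 0
  then show ?thesis
    using f L_second[of "D f" n] degree_D[OF f] by (simp add: coeff_D_top ee_def)
next
  case (Suc m)
  have "degree (D f) \<le> n" using degree_D[OF f] by simp
  moreover have "coeff (D f) n = of_nat (Suc n) * coeff f (Suc n)"
    using f by (rule coeff_D_top)
  moreover have "coeff (D f) (n - 1) = of_nat n * coeff f n
      + c4/12 * of_nat (Suc n) * of_nat n * of_nat (2 * m + 3) * coeff f (Suc n)"
    using f coeff_D_second[of f m] by (simp add: Suc)
  ultimately show ?thesis
    using L_second[of "D f" n] by (simp add: Suc dd_def ee_def) (simp add: field_simps power2_eq_square)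
qed

text \<open>The factor of level k + i acts on degree n - 1 - i and multiplies the leading
  coefficient by d at 2(k + i) + (n - 1 - i).\<close>

lemma rodrigues_poly_top:
  "degree (rodrigues_poly n k) \<le> n
   \<and> coeff (rodrigues_poly n k) n = (\<Prod>i<n. dd (2 * k + (n - 1) + i))"
proof (induction n arbitrary: k)
  case (Suc n)
  obtain b' c' e' where \<phi>: "\<phi>\<^sub>s k = [:c', b', a:]" and \<psi>: "\<psi>\<^sub>s k = [:e', dd (2 * k):]"
    using phi_psi_seq[of k] by blast
  note IH = Suc.IH[of "Suc k"]
  \<comment> \<open>Truncation of \<open>n - 1\<close> at \<open>n = 0\<close> is harmless: the
    product is then empty.\<close>
  have "(\<Prod>i<n. dd (2 * Suc k + (n - 1) + i)) = (\<Prod>i<n. dd (2 * k + (Suc n - 1) + Suc i))"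
    by (intro prod.cong refl arg_cong[of _ _ dd]) auto
  moreover have "a * of_nat n + dd (2 * k) = dd (2 * k + n)"
    by (simp add: dd_def algebra_simps)
  ultimately show ?case
    using L_top(1)[OF IH[THEN conjunct1], of c' b' a e' "dd (2 * k)"]
      L_top(2)[OF IH[THEN conjunct1], of c' b' a e' "dd (2 * k)"] IH
    by (simp only: rodrigues_poly.simps \<phi> \<psi> prod.lessThan_Suc_shift) simp
qed simp

text \<open>Let q be the zero -e'/s of psi. Testing on 1 gives v(z - q) = 0, testing on z gives
  v(phi) = -s v(z(z - q)), and expanding phi at q gives v(phi) = phi(q) v(1) + r v(z(z - q)).
  Eliminate v(z(z - q)).\<close>

lemma functional_phi:
  assumes v: "poly_functional v" "\<And>f. v (L [:c', b', r:] [:e', s:] f) = 0" and s: "s \<noteq> 0"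
  shows "(r + s) * v [:c', b', r:] = s * poly [:c', b', r:] (- e' / s) * v 1"
proof -
  note vs = fun_simps[OF v(1)]
  define z where "z = ([:0, 1:] :: complex poly)"
  have lin: "v [:x, y, w:] = x * v 1 + y * v z + w * v (z * z)" for x y w
  proof -
    have "[:x, y, w:] = smult x 1 + smult y z + smult w (z * z)"
      by (simp add: z_def one_pCons)
    then show ?thesis by (simp only: vs)
  qed
  have lin': "v [:x, y:] = x * v 1 + y * v z" for x y
    using lin[of x y 0] by simp
  have "L [:c', b', r:] [:e', s:] 1 = [:e', s:]"
    by (simp add: L_def)
  then have 1: "e' * v 1 + s * v z = 0"
    using v(2)[of 1] by (simp only: lin')
  have "L [:c', b', r:] [:e', s:] z = [:c', b', r:] + [:c4/4 * e', e' + c4/4 * s, s:]"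
    by (simp add: L_def z_def Dx_pCons Sx_pCons)
  then have "v [:c', b', r:] + (c4/4 * e' * v 1 + (e' + c4/4 * s) * v z + s * v (z * z)) = 0"
    using v(2)[of z] by (simp only: vs lin)
  then have 2: "v [:c', b', r:] + e' * v z + s * v (z * z) = 0"
    using 1 by algebra
  have "v z = - e' / s * v 1"
    using 1 s by (simp add: field_simps eq_neg_iff_add_eq_0)
  moreover define q where "q = - e' / s"
  moreover have "e' = - q * s" using s by (simp add: q_def)
  ultimately show ?thesis
    using 2 unfolding lin q_def[symmetric] by simp algebra
qed

section \<open>The values u_n(1) and orthogonality of the Rodrigues polynomials\<close>

text \<open>The zero of \<open>\<psi>\<^sup>[\<^sup>n\<^sup>]\<close>.\<close>

definition rho :: "nat \<Rightarrow> complex"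
  where "rho n = - (c4/4) * of_nat n ^ 2 - ee n / dd (2 * n)"

lemma u_seq_Suc_1:
  assumes "dd (2 * n) \<noteq> 0" "dd (2 * n + 1) \<noteq> 0"
  shows "u\<^sub>s (Suc n) 1 = - dd (2 * n) / dd (2 * n + 1) * poly (\<phi>\<^sub>s n) (rho n) * u\<^sub>s n 1"
proof -
  obtain b' c' where \<phi>: "\<phi>\<^sub>s n = [:c', b', a:]"
    and \<psi>: "\<psi>\<^sub>s n = [:ee n + c4/4 * of_nat n ^ 2 * dd (2 * n), dd (2 * n):]"
    using phi_psi_seq[of n] by blast
  have "- (ee n + c4/4 * of_nat n ^ 2 * dd (2 * n)) / dd (2 * n) = rho n"
    using assms by (simp add: rho_def field_simps)
  moreover have "a + dd (2 * n) = dd (2 * n + 1)" by (simp add: dd_def algebra_simps)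
  ultimately have "dd (2 * n + 1) * u\<^sub>s n (\<phi>\<^sub>s n) = dd (2 * n) * poly (\<phi>\<^sub>s n) (rho n) * u\<^sub>s n 1"
    using functional_phi[of "u\<^sub>s n" c' b' a _ "dd (2 * n)"] pearson_seq[of n] assms
    by (metis \<phi> \<psi>)
  moreover have "u\<^sub>s (Suc n) 1 = - u\<^sub>s n (\<phi>\<^sub>s n)"
    by (simp add: u_seq_Suc_M M_def del: u_seq.simps)
  ultimately show ?thesis using assms by (simp add: field_simps del: u_seq.simps)
qed

text \<open>For \<open>i < n\<close> the subtraction \<open>n - 1\<close> does not truncate.\<close>

definition lambda :: "nat \<Rightarrow> complex" where "lambda n = (\<Prod>i<n. dd (n - 1 + i))"

text \<open>D^n leaves only the coefficient of z^n, so one formula yields both orthogonality to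
  lower degrees and the norms.\<close>

lemma u_rodrigues_poly:
  assumes "degree f \<le> n"
  shows "u (f * rodrigues_poly n 0) = fact n * coeff f n * u\<^sub>s n 1"
proof -
  have "u (f * rodrigues_poly n 0) = u\<^sub>s n [:fact n * coeff f n:]"
    using rodrigues[of 0 n f] D_funpow[OF assms] by simp
  then show ?thesis
    using fun_smult_poly[OF pearson_seq[THEN conjunct1], of n _ 1] by simp
qed

lemma rodrigues_poly_0_top:
  assumes "lambda n \<noteq> 0"
  shows "degree (rodrigues_poly n 0) = n" "coeff (rodrigues_poly n 0) n = lambda n"
  using rodrigues_poly_top[of n 0] assms le_degree[of "rodrigues_poly n 0" n]
  by (auto simp: lambda_def)

text \<open>As no d_m vanishes, subtracting some L q, which \<open>u\<close> annihilates, lowers the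
  degree of any nonconstant \<open>f\<close>. Thus \<open>u\<close> is determined by
  \<open>u 1\<close>.\<close>

lemma u_1_nonzero:
  assumes ne: "u \<noteq> (\<lambda>_. 0)" and dd: "\<And>n. dd n \<noteq> 0"
  shows "u 1 \<noteq> 0"
proof
  assume u1: "u 1 = 0"
  note us = fun_simps[OF lin]
  have "u f = 0" if "\<And>i. i \<ge> n \<Longrightarrow> coeff f i = 0" for n f
    using that
  proof (induction n arbitrary: f)
    case 0
    then have "f = 0" by (simp add: poly_eq_iff)
    then show ?case by (simp add: us)
  next
    case (Suc n)
    then have deg: "degree f \<le> n"
      by (intro degree_le) (simp add: Suc_le_eq)
    show ?case
    proof (cases n)
      case 0
      then have "f = smult (coeff f 0) 1"
        using deg degree_0_id[of f] by simp
      then show ?thesis using u1 by (metis us(2) mult_zero_right)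
    next
      case (Suc m)
      define q where "q = monom (coeff f n / dd m) m"
      have q: "degree q \<le> m" by (simp add: q_def degree_monom_le)
      have "coeff (f - L [:c, b, a:] [:e, d:] q) i = 0" if "i \<ge> n" for i
      proof (cases "i = n")
        case True
        then show ?thesis
          using L_top(2)[OF q, of c b a e d] dd[of m] by (simp add: q_def Suc dd_def)
      next
        case False
        then show ?thesis
          using L_top(1)[OF q, of c b a e d] deg that by (simp add: Suc coeff_eq_0)
      qed
      then have "u (f - L [:c, b, a:] [:e, d:] q) = 0" by (rule Suc.IH)
      then show ?thesis by (simp add: us pe)
    qed
  qed
  then have "u f = 0" for f
    by (metis Suc_le_lessD coeff_eq_0)
  then show False using ne by auto
qed

section \<open>The eigenvalue equation and the necessity of nonzero d_n\<close>

lemma bochner_eigen: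
  assumes P: "is_monic_OPS u P"
  shows "L [:c, b, a:] [:e, d:] (D (P (Suc n))) = smult (of_nat (Suc n) * dd n) (P (Suc n))"
proof -
  note PD = monic_OPS_D[OF lin P]
  let ?r = "of_nat (Suc n) * dd n" and ?L = "L [:c, b, a:] [:e, d:]"
  have "?L (D (P (Suc n))) - smult ?r (P (Suc n)) = 0"
  \<comment> \<open>The leading terms cancel, so testing against \<open>P k\<close> with
    \<open>k \<le> n\<close> suffices. Symmetry moves L D onto \<open>P k\<close>, where it does not
    raise the degree.\<close>
  proof (rule OPS_nondegenerate[OF lin PD(1), of "Suc n"])
    fix k assume k: "k < Suc n"
    have "coeff (?L (D (P k))) i = 0" if "i \<ge> Suc n" for i
    proof -
      have "degree (D (P k)) \<le> k - 1" using degree_D[of "P k" k] PD by simp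
      then have "degree (?L (D (P k))) \<le> Suc (k - 1)" by (rule L_top)
      \<comment> \<open>At \<open>k = 0\<close> truncation makes the bound 1, too weak when
        \<open>n = 0\<close>; there D (P 0) = 0 is used.\<close>
      then have "degree (?L (D (P k))) < i \<or> k = 0" using k that by auto
      moreover have "D (P 0) = 0"
        using coeff_D_ge[of "P 0"] PD(2)[of 0] by (simp add: poly_eq_iff)
      ultimately show ?thesis by (auto simp: coeff_eq_0 L_0)
    qed
    then have "u (P (Suc n) * ?L (D (P k))) = 0"
      using OPS_orthogonal[OF lin PD(1)] by blast
    then have "u (P k * ?L (D (P (Suc n)))) = 0"
      using bochner_symmetric[of "P k" "P (Suc n)"] by simp
    moreover have "u (P k * P (Suc n)) = 0"
      using PD(1) k by (auto simp: is_OPS_def)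
    ultimately show "u (P k * (?L (D (P (Suc n))) - smult ?r (P (Suc n)))) = 0"
      by (simp add: right_diff_distrib fun_simps[OF lin])
  next
    fix i assume i: "Suc n \<le> i"
    show "coeff (?L (D (P (Suc n))) - smult ?r (P (Suc n))) i = 0"
    proof (cases "i = Suc n")
      case True
      then show ?thesis using bochner_top[of "P (Suc n)" n] PD by simp
    next
      case False
      then show ?thesis using bochner_top(1)[of "P (Suc n)" n] PD i by (simp add: coeff_eq_0)
    qed
  qed
  then show ?thesis by simp
qed

lemma dd_nonzero:
  assumes reg: "regular u" and ne: "([:c, b, a:], [:e, d:]) \<noteq> (0, 0)"
  shows "dd n \<noteq> 0"
proof
  assume "dd n = 0"
  obtain P where P: "is_monic_OPS u P" using regular_imp_monic_OPS[OF lin reg] by blast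
  have "L [:c, b, a:] [:e, d:] (D (P (Suc n))) = 0"
    using bochner_eigen[OF P, of n] \<open>dd n = 0\<close> by simp
  then have "D (P (Suc n)) = 0"
    by (rule L_eq_0_imp_eq_0[OF lin pe reg ne])
  then show False
    using coeff_D_top[of "P (Suc n)" n] monic_OPS_D[OF lin P]
    by (simp del: of_nat_Suc)
qed

text \<open>Compare the coefficients of z^n in the eigenvalue equation; the unknown is multiplied by
  the eigenvalue difference \<open>dd (2 * n)\<close>.\<close>

lemma monic_OPS_second_coeff:
  assumes P: "is_monic_OPS u P" and dd: "dd (2 * n) \<noteq> 0"
  shows "coeff (P (Suc n)) n
    = of_nat (Suc n) * ee n / dd (2 * n) + c4/6 * of_nat (Suc n) * of_nat n * (of_nat n - 1)"
proof -
  note PD = monic_OPS_D[OF lin P]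
  have "of_nat (Suc n) * dd n * coeff (P (Suc n)) n = of_nat n * dd (n - 1) * coeff (P (Suc n)) n
    + (of_nat (Suc n) * ee n + c4/6 * of_nat (Suc n) * of_nat n * (of_nat n - 1) * dd (2 * n))"
    using bochner_second[of "P (Suc n)" n] bochner_eigen[OF P, of n] PD by simp
  moreover have "of_nat (Suc n) * dd n - of_nat n * dd (n - 1) = dd (2 * n)"
    by (cases n) (simp_all add: dd_def algebra_simps)
  ultimately have "dd (2 * n) * coeff (P (Suc n)) n
    = of_nat (Suc n) * ee n + c4/6 * of_nat (Suc n) * of_nat n * (of_nat n - 1) * dd (2 * n)"
    by algebra
  then show ?thesis using dd by (simp add: divide_simps) (simp add: algebra_simps)
qed

lemma monic_OPS_rodrigues_poly:
  assumes P: "is_monic_OPS u P" and dd: "\<And>n. dd n \<noteq> 0"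
  shows "rodrigues_poly n 0 = smult (lambda n) (P n)"
    and "u (P n * P n) = fact n * u\<^sub>s n 1 / lambda n"
proof -
  note PD = monic_OPS_D[OF lin P]
  have l: "lambda n \<noteq> 0" by (simp add: lambda_def dd)
  note Q = rodrigues_poly_0_top[OF l]
  define R where "R = smult (inverse (lambda n)) (rodrigues_poly n 0)"
  have "R = P n"
  proof (rule monic_OPS_unique[OF lin P])
    fix f :: "complex poly" assume f: "\<And>i. n \<le> i \<Longrightarrow> coeff f i = 0"
    then have "degree f \<le> n" by (intro degree_le) simp
    then show "u (R * f) = 0"
      using u_rodrigues_poly[of f n] f[of n]
      by (simp add: R_def fun_simps[OF lin] mult.commute[of _ f])
  qed (use Q l in \<open>simp_all add: R_def\<close>)
  then show eq: "rodrigues_poly n 0 = smult (lambda n) (P n)"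
    using l by (simp add: R_def flip: \<open>R = P n\<close>)
  have "lambda n * u (P n * P n) = fact n * u\<^sub>s n 1"
    using u_rodrigues_poly[of "P n" n] PD by (simp add: eq fun_simps[OF lin])
  then show "u (P n * P n) = fact n * u\<^sub>s n 1 / lambda n"
    using l by (simp add: field_simps)
qed

text \<open>Both sides say that no u_n(1) vanishes: these numbers are the norms up to nonzero
  factors, and consecutive ones differ by a nonzero multiple of phi^[n] at
  \<open>rho n\<close>.\<close>

lemma regular_iff:
  assumes ne: "u \<noteq> (\<lambda>_. 0)" and dd: "\<And>n. dd n \<noteq> 0"
  shows "regular u \<longleftrightarrow> (\<forall>n. poly (\<phi>\<^sub>s n) (rho n) \<noteq> 0)"
proof -
  have l: "lambda n \<noteq> 0" for n by (simp add: lambda_def dd)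
  have "(\<forall>n. u\<^sub>s n 1 \<noteq> 0) \<longleftrightarrow> (\<forall>n. poly (\<phi>\<^sub>s n) (rho n) \<noteq> 0)"
  proof (intro iffI allI)
    fix n assume "\<forall>n. u\<^sub>s n 1 \<noteq> 0"
    then show "poly (\<phi>\<^sub>s n) (rho n) \<noteq> 0"
      using u_seq_Suc_1[OF dd dd, of n] by (metis mult_zero_left mult_zero_right)
  next
    fix n assume *: "\<forall>n. poly (\<phi>\<^sub>s n) (rho n) \<noteq> 0"
    show "u\<^sub>s n 1 \<noteq> 0"
    proof (induction n)
      case 0
      then show ?case using u_1_nonzero[OF ne dd] by simp
    next
      case (Suc n)
      then show ?case
        using * u_seq_Suc_1[OF dd dd, of n] dd by (simp del: u_seq.simps)
    qed
  qed
  moreover have "regular u \<longleftrightarrow> (\<forall>n. u\<^sub>s n 1 \<noteq> 0)"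
  proof
    assume "regular u"
    then obtain P where P: "is_monic_OPS u P" using regular_imp_monic_OPS[OF lin] by blast
    show "\<forall>n. u\<^sub>s n 1 \<noteq> 0"
      using monic_OPS_rodrigues_poly(2)[OF P dd] monic_OPS_D(4)[OF lin P]
      by (metis div_0 mult_zero_right)
  next
    assume w: "\<forall>n. u\<^sub>s n 1 \<noteq> 0"
    define P where "P n = smult (inverse (lambda n)) (rodrigues_poly n 0)" for n
    have P: "degree (P n) = n" "coeff (P n) n = 1" for n
      using rodrigues_poly_0_top[OF l, of n] l[of n] by (simp_all add: P_def)
    have pair: "u (P n * f) = inverse (lambda n) * (fact n * coeff f n * u\<^sub>s n 1)"
      if "degree f \<le> n" for n f
      using u_rodrigues_poly[OF that] by (simp add: P_def fun_simps[OF lin] mult.commute[of _ f])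
    have "is_monic_OPS u P"
    proof (rule is_monic_OPS_I[OF lin P])
      fix n and f :: "complex poly" assume f: "\<And>i. n \<le> i \<Longrightarrow> coeff f i = 0"
      then have "degree f \<le> n" by (intro degree_le) simp
      then show "u (P n * f) = 0" using pair f[of n] by simp
    next
      fix n show "u (P n * P n) \<noteq> 0"
        using pair[of "P n" n] P l w by simp
    qed
    then show "regular u" by (auto simp: is_monic_OPS_def regular_def)
  qed
  ultimately show ?thesis by simp
qed

section \<open>Recurrence coefficients and the Rodrigues formula\<close>

lemma lambda_quotient:
  assumes dd: "\<And>n. dd n \<noteq> 0"
  shows "lambda n / lambda (Suc n)
    = (if n = 0 then 1 else dd (n - 1) / dd (2 * n - 1)) / dd (2 * n)"
proof (cases n)
  case 0
  then show ?thesis by (simp add: lambda_def)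
next
  case (Suc m)
  \<comment> \<open>The product from d_(n-1) to d_(2n) contains both ranges: \<open>lambda n\<close>
    omits its last two factors, \<open>lambda (Suc n)\<close> its first.\<close>
  define p where "p k = (\<Prod>i<k. dd (m + i))" for k
  have "p (Suc (Suc (Suc m))) = p (Suc m) * dd (2 * m + 1) * dd (2 * m + 2)"
    by (simp add: p_def mult_2)
  moreover have "p (Suc (Suc (Suc m))) = dd m * lambda (Suc n)"
    unfolding p_def prod.lessThan_Suc_shift[of _ "Suc (Suc m)"] by (simp add: lambda_def Suc)
  moreover have "p (Suc m) = lambda n"
    by (simp add: p_def lambda_def Suc)
  ultimately have "lambda n * dd (2 * m + 1) * dd (2 * m + 2) = dd m * lambda (Suc n)"
    by simp
  moreover have "lambda (Suc n) \<noteq> 0" by (simp add: lambda_def dd)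
  ultimately show ?thesis using dd Suc by (simp add: field_simps)
qed

lemma monic_OPS_norm_quotient:
  assumes P: "is_monic_OPS u P" and dd: "\<And>n. dd n \<noteq> 0"
  shows "u (P (Suc n) * P (Suc n)) / u (P n * P n)
    = - (of_nat (Suc n) * (if n = 0 then 1 else dd (n - 1) / dd (2 * n - 1)) / dd (2 * n + 1))
        * poly (\<phi>\<^sub>s n) (rho n)"
proof -
  note h = monic_OPS_rodrigues_poly(2)[OF P dd]
  define q where "q = (if n = 0 then 1 else dd (n - 1) / dd (2 * n - 1))"
  have l: "lambda k \<noteq> 0" for k by (simp add: lambda_def dd)
  have w: "u\<^sub>s n 1 \<noteq> 0"
    using h[of n] monic_OPS_D(4)[OF lin P, of n] by auto
  have "u (P (Suc n) * P (Suc n)) / u (P n * P n)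
      = of_nat (Suc n) * (u\<^sub>s (Suc n) 1 / u\<^sub>s n 1) * (lambda n / lambda (Suc n))"
    unfolding h using l w by (simp add: field_simps del: u_seq.simps)
  also have "u\<^sub>s (Suc n) 1 / u\<^sub>s n 1 = - dd (2 * n) / dd (2 * n + 1) * poly (\<phi>\<^sub>s n) (rho n)"
    unfolding u_seq_Suc_1[OF dd dd] using w by simp
  also have "lambda n / lambda (Suc n) = q / dd (2 * n)"
    unfolding lambda_quotient[OF dd] q_def ..
  finally show ?thesis
    using dd[of "2 * n"] by (simp add: q_def[symmetric])
qed

text \<open>The cubic terms combine by n(n-1)(n-2)/6 - (n+1)n(n-1)/6 = -n(n-1)/2.\<close>

lemma monic_OPS_second_coeff_diff:
  assumes P: "is_monic_OPS u P" and dd: "\<And>n. dd n \<noteq> 0"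
  shows "(if n = 0 then 0 else coeff (P n) (n - 1)) - coeff (P (Suc n)) n
    = (if n = 0 then 0 else of_nat n * ee (n - 1) / dd (2 * n - 2))
        - of_nat (Suc n) * ee n / dd (2 * n) - c4/2 * of_nat n * (of_nat n - 1)"
proof (cases n)
  case 0
  then show ?thesis using monic_OPS_second_coeff[OF P dd, of 0] by simp
next
  case (Suc m)
  define x y where "x = of_nat n * ee m / dd (2 * m)" and "y = of_nat (Suc n) * ee n / dd (2 * n)"
  have "coeff (P n) m = x + c4/6 * of_nat n * of_nat m * (of_nat m - 1)"
    "coeff (P (Suc n)) n = y + c4/6 * of_nat (Suc n) * of_nat n * (of_nat n - 1)"
    using monic_OPS_second_coeff[OF P dd] by (simp_all only: Suc x_def y_def)
  then have "coeff (P n) m - coeff (P (Suc n)) n = x - y - c4/2 * of_nat n * (of_nat n - 1)"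
    by (simp add: Suc) (simp add: field_simps)
  then show ?thesis by (simp add: Suc x_def y_def)
qed

lemma monic_OPS_rodrigues:
  assumes P: "is_monic_OPS u P" and dd: "\<And>n. dd n \<noteq> 0"
  shows "u (f * P n) = (- 1) ^ n / lambda n * (Dx_dual c4 c5 c6 ^^ n) (u\<^sub>s n) f"
proof -
  have "lambda n \<noteq> 0" by (simp add: lambda_def dd)
  moreover have "u\<^sub>s n ((D ^^ n) f) = lambda n * u (f * P n)"
    using rodrigues[of 0 n f]
    by (simp add: monic_OPS_rodrigues_poly(1)[OF P dd] fun_simps[OF lin])
  \<comment> \<open>One sign comes from k_n, the other from the n dual operators.\<close>
  moreover have "(- 1) ^ n * (- 1) ^ n = (1 :: complex)"
    by (simp flip: power_mult_distrib)
  ultimately show ?thesis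
    by (simp add: Dx_dual_funpow)
qed

end

text \<open>Integer arguments of \<open>dn\<close> and \<open>en\<close> keep indices such as 2n - 2
  free of truncation. The sequence \<open>phin\<close> is the recursive one; its explicit form is
  the first conjunct.\<close>

theorem theorem4p2:
  fixes c4 c5 c6 \<beta> a b c d e :: complex
    and u :: "complex poly \<Rightarrow> complex"
    and \<phi> \<psi> :: "complex poly"
    and dn en :: "int \<Rightarrow> complex"
    and phin :: "nat \<Rightarrow> complex poly"
    and un :: "nat \<Rightarrow> complex poly \<Rightarrow> complex"
    and B C k :: "nat \<Rightarrow> complex"
  assumes lattice: "(c4, c5, c6) \<noteq> (0, 0, 0)"
    and beta: "\<beta> = c4 / 4"
    and u_dual: "poly_functional u"
    and u_nonzero: "u \<noteq> (\<lambda>_. 0)"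
    and phi: "\<phi> = [:c, b, a:]"
    and psi: "\<psi> = [:e, d:]"
    and phi_psi: "(\<phi>, \<psi>) \<noteq> (0, 0)"
    and pearson: "Dx_dual c4 c5 c6 (fun_mult \<phi> u) = Sx_dual c4 c5 c6 (fun_mult \<psi> u)"
    and dn: "\<And>n. dn n = a * of_int n + d"
    and en: "\<And>n. en n = b * of_int n + e + 2 * \<beta> * d * (of_int n)^2"
    and phin: "\<And>n. phin n = phi_seq c4 c5 c6 \<phi> \<psi> n"
    and un: "\<And>n. un n = u_seq c4 c5 c6 \<phi> \<psi> u n"
    and B: "\<And>n. B n = (if n = 0 then 0 else of_nat n * en (int n - 1) / dn (2 * int n - 2))
                 - of_nat (n + 1) * en (int n) / dn (2 * int n)
                 - 2 * \<beta> * of_nat n * (of_nat n - 1)"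
    and C: "\<And>n. C (n + 1) =
                 - (of_nat (n + 1) * (if n = 0 then 1 else dn (int n - 1) / dn (2 * int n - 1))
                      / dn (2 * int n + 1))
                 * poly (phin n) (- \<beta> * (of_nat n)^2 - en (int n) / dn (2 * int n))"
    and k: "\<And>n. k n = (-1)^n * (\<Prod>j=1..n. inverse (dn (int n + int j - 2)))"
  shows "(\<forall>n z. poly (phin n) z =
            a * z^2 + (b + 6 * \<beta> * of_nat n * dn (int n)) * z
            + poly \<phi> (\<beta> * (of_nat n)^2) + 2 * \<beta> * of_nat n * poly \<psi> (\<beta> * (of_nat n)^2)
            - of_nat n / 4 * (16 * \<beta> * c6 - c5^2) * dn (int n))
    \<and> (regular u \<longleftrightarrow>
         (\<forall>n::nat. dn (int n) \<noteq> 0 \<and>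
            poly (phin n) (- \<beta> * (of_nat n)^2 - en (int n) / dn (2 * int n)) \<noteq> 0))
    \<and> (regular u \<longrightarrow>
         (\<exists>!P. is_monic_OPS u P) \<and>
         (\<forall>P. is_monic_OPS u P \<longrightarrow>
            (\<forall>n. P (n + 1) = [:- B n, 1:] * P n - (if n = 0 then 0 else smult (C n) (P (n - 1))))
            \<and> (\<forall>n. fun_mult (P n) u = (\<lambda>f. k n * ((Dx_dual c4 c5 c6 ^^ n) (un n)) f))))"
proof -
  have pe: "u (quadratic_lattice.L c4 c5 c6 [:c, b, a:] [:e, d:] f) = 0" for f
    using fun_cong[OF pearson, of f]
    by (simp add: quadratic_lattice.L_def Dx_dual_def Sx_dual_def fun_mult_def phi psi
        fun_add[OF u_dual] mult.commute neg_eq_iff_add_eq_0 del: mult_pCons_left mult_pCons_right)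
  interpret quadratic_pearson c4 c5 c6 a b c d e u
    by unfold_locales (fact u_dual, fact pe)
  have dn_eq: "dn (int n) = dd n" and en_eq: "en (int n) = ee n" for n
    by (simp_all add: dn en dd_def ee_def beta)
  have phin_eq: "phin n = \<phi>\<^sub>s n" for n
    by (simp add: phin phi psi)
  have dn2: "dn (2 * int n) = dd (2 * n)" "dn (2 * int n + 1) = dd (2 * n + 1)" for n
    by (simp_all add: dn dd_def)
  have rho: "- \<beta> * (of_nat n)^2 - en (int n) / dn (2 * int n) = rho n" for n
    by (simp add: rho_def beta dn2 en_eq)
  have ne: "([:c, b, a:], [:e, d:]) \<noteq> (0, 0)"
    using phi_psi by (simp only: phi psi not_False_eq_True)
  have C_eq: "C (Suc n) = - (of_nat (Suc n) * (if n = 0 then 1 else dd (n - 1) / dd (2 * n - 1))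
      / dd (2 * n + 1)) * poly (\<phi>\<^sub>s n) (rho n)" for n
  proof -
    have "(if n = 0 then 1 else dn (int n - 1) / dn (2 * int n - 1))
        = (if n = 0 then 1 else dd (n - 1) / dd (2 * n - 1))"
      by (cases n) (simp_all add: dn dd_def)
    then show ?thesis
      using C[of n] unfolding rho unfolding dn2 phin_eq by simp
  qed
  have B_eq: "B n = (if n = 0 then 0 else of_nat n * ee (n - 1) / dd (2 * n - 2))
      - of_nat (Suc n) * ee n / dd (2 * n) - c4/2 * of_nat n * (of_nat n - 1)" for n
  proof -
    have "(if n = 0 then 0 else of_nat n * en (int n - 1) / dn (2 * int n - 2))
        = (if n = 0 then 0 else of_nat n * ee (n - 1) / dd (2 * n - 2))"
      by (cases n) (simp_all add: dn dd_def en_eq)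
    then show ?thesis
      using B[of n] unfolding dn2 en_eq by (simp add: beta)
  qed
  have k_eq: "k n = (- 1) ^ n / lambda n" for n
  proof -
    have "(\<Prod>j=1..n. inverse (dn (int n + int j - 2)))
        = (\<Prod>i<n. inverse (dn (int n + int (Suc i) - 2)))"
      by (simp only: One_nat_def prod.atLeast1_atMost_eq)
    also have "\<dots> = (\<Prod>i<n. inverse (dd (n - 1 + i)))"
    proof (rule prod.cong[OF refl])
      fix i assume "i \<in> {..<n}"
      \<comment> \<open>\<open>i < n\<close> forces \<open>n > 0\<close>, so the natural subtraction
        is exact.\<close>
      then have "int n + int (Suc i) - 2 = int (n - 1 + i)" by auto
      then show "inverse (dn (int n + int (Suc i) - 2)) = inverse (dd (n - 1 + i))"
        by (simp only: dn_eq)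
    qed
    finally show ?thesis
      by (simp only: k lambda_def divide_inverse prod_inversef[symmetric] o_def)
  qed
  have explicit: "poly (phin n) z =
      a * z^2 + (b + 6 * \<beta> * of_nat n * dn (int n)) * z
      + poly \<phi> (\<beta> * (of_nat n)^2) + 2 * \<beta> * of_nat n * poly \<psi> (\<beta> * (of_nat n)^2)
      - of_nat n / 4 * (16 * \<beta> * c6 - c5^2) * dn (int n)" for n z
    unfolding phin_eq dn_eq phi_psi_seq[of n, THEN conjunct1]
    by (simp add: phi psi beta power2_eq_square) (simp add: algebra_simps)
  \<comment> \<open>\<open>regular_iff\<close> presupposes nonzero \<open>dd\<close>: one direction
    assumes this, the other gets it from \<open>dd_nonzero\<close>.\<close>
  have iff: "regular u \<longleftrightarrow> (\<forall>n. dd n \<noteq> 0 \<and> poly (\<phi>\<^sub>s n) (rho n) \<noteq> 0)"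
    using dd_nonzero[OF _ ne] regular_iff[OF u_nonzero] by blast
  have rec: "P (n + 1) = [:- B n, 1:] * P n - (if n = 0 then 0 else smult (C n) (P (n - 1)))"
    and rod: "fun_mult (P n) u = (\<lambda>f. k n * ((Dx_dual c4 c5 c6 ^^ n) (un n)) f)"
    if P: "is_monic_OPS u P" for P n
  proof -
    have "regular u" using P by (auto simp: regular_def is_monic_OPS_def)
    then have dd: "dd n \<noteq> 0" for n using ne by (rule dd_nonzero)
    show "P (n + 1) = [:- B n, 1:] * P n - (if n = 0 then 0 else smult (C n) (P (n - 1)))"
      unfolding Suc_eq_plus1[symmetric]
    proof (rule monic_OPS_recurrence[OF u_dual P])
      show "B n = (if n = 0 then 0 else coeff (P n) (n - 1)) - coeff (P (Suc n)) n" for n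
        unfolding monic_OPS_second_coeff_diff[OF P dd] by (rule B_eq)
      show "C (Suc n) = u (P (Suc n) * P (Suc n)) / u (P n * P n)" for n
        unfolding monic_OPS_norm_quotient[OF P dd] by (rule C_eq)
    qed
    show "fun_mult (P n) u = (\<lambda>f. k n * ((Dx_dual c4 c5 c6 ^^ n) (un n)) f)"
      unfolding fun_mult_def k_eq un phi psi
      using monic_OPS_rodrigues[OF P dd] by blast
  qed
  have uniq: "P = Q" if P: "is_monic_OPS u P" and Q: "is_monic_OPS u Q" for P Q
  proof
    fix n
    note QD = monic_OPS_D[OF u_dual Q]
    show "P n = Q n"
      using monic_OPS_unique[OF u_dual P QD(2) QD(3)] OPS_orthogonal[OF u_dual QD(1) _ le_refl]
      by metis
  qed
  have "regular u \<longrightarrow> (\<exists>!P. is_monic_OPS u P)"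
    using regular_imp_monic_OPS[OF u_dual] uniq by blast
  moreover have "regular u \<longleftrightarrow> (\<forall>n::nat. dn (int n) \<noteq> 0 \<and>
      poly (phin n) (- \<beta> * (of_nat n)^2 - en (int n) / dn (2 * int n)) \<noteq> 0)"
    unfolding rho dn_eq phin_eq by (rule iff)
  ultimately show ?thesis
    using explicit rec rod by blast
qed

end
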